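(* Let $\mathbf{P}$ be a property that a deformation of $\overline\rho$ may or may not satisfy, which depends only on the equivalence class of the representation and which $\overline\rho$ satisfies. Let $\rho^{\mathrm{univ}}:G_K\to\mathrm{GL}_2(R^{\mathrm{univ}})$ be a deformation of $\overline\rho$ universal for $\mathbf{P}$: for every deformation $\rho:G_K\to\mathrm{GL}_2(R)$ having $\mathbf{P}$ there is a unique morphism $\phi:R^{\mathrm{univ}}\to R$ with $\rho=\phi\circ\rho^{\mathrm{univ}}$. Suppose that $\rho^{\mathrm{univ}}=\mathrm{Ind}_{G_L}^{G_K}(\chi)$ for a character $\chi:G_L\to(R^{\mathrm{univ}})^\times$ lifting $\overline\chi$, and that $\rho^{\mathrm{univ}}$ is unramified above $p$. Let $\mathfrak n$ be an ideal of $\mathcal{O}_K$ coprime to $p$, $\mathbb{T}_{\mathrm{dih}}$ a quotient of $\mathbb{T}_{1,\mathfrak n}$ which is a complete Noetherian local $W(\mathbb{F})$-algebra with residue field $\mathbb{F}$, $\rho_{\mathrm{dih}}:G_K\to\mathrm{GL}_2(\mathbb{T}_{\mathrm{dih}})$ a deformation of $\overline\rho$ with $\mathrm{tr}(\rho_{\mathrm{dih}}(\mathrm{Frob}_{\mathfrak q}))=T_{\mathfrak q}$ for all primes $\mathfrak q\nmid p\mathfrak n$, and $\psi:\mathbb{T}_{\mathrm{dih}}\to R^{\mathrm{univ}}$ a ring homomorphism with $\psi\circ\rho_{\mathrm{dih}}=\rho^{\mathrm{univ}}$ (such data exist for $\rho^{\mathrm{univ}}$). Suppose further that $\rho_{\mathrm{dih}}$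 also satisfies $\mathbf{P}$. Then $R^{\mathrm{univ}}\cong\mathbb{T}_{\mathrm{dih}}$.
   Context: Let $p$ be a prime, $\mathbb{F}$ a finite field of characteristic $p$, $W(\mathbb{F})$ its Witt vectors, $\mathcal{C}$ the category of complete local Noetherian $W(\mathbb{F})$-algebras with residue field $\mathbb{F}$; deformations are continuous lifts to $\mathrm{GL}_2$ of rings in $\mathcal{C}$. Let $K$ be a totally real number field, $L$ a quadratic extension, $\overline\chi:G_L\to\mathbb{F}^\times$ a character with $\overline\rho=\mathrm{Ind}_{G_L}^{G_K}(\overline\chi):G_K\to\mathrm{GL}_2(\mathbb{F})$ absolutely irreducible and totally odd. Fix $\mathbb{C}\cong\overline{\mathbb{Q}}_p$; $\mathbb{T}_{1,\mathfrak n}$ is the $W(\mathbb{F})$-algebra generated by the Hecke operators $T_{\mathfrak q}$, $\mathfrak q\nmid\mathfrak np$ prime, acting faithfully on the space $S_1(\Gamma_1(\mathfrak n),\overline{\mathbb{Q}}_p)$ of cuspidal Hilbert modular forms over $K$ of parallel weight one and level $\Gamma_1(\mathfrak n)$. *)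

theory Defs
  imports
    "HOL-Analysis.Analysis"
    "HOL-Library.Poly_Mapping"
    "HOL-Algebra.Algebra"
    "HOL-Algebra.Algebraic_Closure_Type"
begin

section \<open>Witt vectors\<close>

type_synonym witt_poly = "((nat + nat) \<Rightarrow>\<^sub>0 nat) \<Rightarrow>\<^sub>0 int"

text \<open>
  Integral polynomials in the two families of variables \<open>X\<^sub>i\<close> (index \<open>Inl i\<close>) and
  \<open>Y\<^sub>i\<close> (index \<open>Inr i\<close>).
\<close>

definition poly_var :: "nat + nat \<Rightarrow> witt_poly" where
  "poly_var v = Poly_Mapping.single (Poly_Mapping.single v 1) 1"

definition ghost :: "nat \<Rightarrow> (nat \<Rightarrow> witt_poly) \<Rightarrow> nat \<Rightarrow> witt_poly" where
  "ghost p Z n = (\<Sum>i\<le>n. of_nat (p ^ i) * Z i ^ (p ^ (n - i)))"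

text \<open>
  The sequences of polynomials defining the sum and the product of Witt vectors: by Witt's
  theorem there is exactly one sequence over the integers with the given ghost components.
\<close>

definition witt_sum :: "nat \<Rightarrow> nat \<Rightarrow> witt_poly" where
  "witt_sum p = (THE S. \<forall>n. ghost p S n =
     ghost p (\<lambda>i. poly_var (Inl i)) n + ghost p (\<lambda>i. poly_var (Inr i)) n)"

definition witt_prod :: "nat \<Rightarrow> nat \<Rightarrow> witt_poly" where
  "witt_prod p = (THE S. \<forall>n. ghost p S n =
     ghost p (\<lambda>i. poly_var (Inl i)) n * ghost p (\<lambda>i. poly_var (Inr i)) n)"

definition eval_poly :: "('a, 'b) ring_scheme \<Rightarrow> (nat + nat \<Rightarrow> 'a) \<Rightarrow> witt_poly \<Rightarrow> 'a" where
  "eval_poly A x f =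
     (\<Oplus>\<^bsub>A\<^esub>m\<in>Poly_Mapping.keys f.
        [Poly_Mapping.lookup f m] \<cdot>\<^bsub>A\<^esub>
          (\<Otimes>\<^bsub>A\<^esub>v\<in>Poly_Mapping.keys m. x v [^]\<^bsub>A\<^esub> Poly_Mapping.lookup m v))"

definition Witt :: "nat \<Rightarrow> ('a, 'b) ring_scheme \<Rightarrow> (nat \<Rightarrow> 'a) ring" where
  "Witt p A = \<lparr> carrier = {a. \<forall>n. a n \<in> carrier A},
     monoid.mult = (\<lambda>a b n. eval_poly A (case_sum a b) (witt_prod p n)),
     one = (\<lambda>n. if n = 0 then \<one>\<^bsub>A\<^esub> else \<zero>\<^bsub>A\<^esub>),
     ring.zero = (\<lambda>n. \<zero>\<^bsub>A\<^esub>),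
     add = (\<lambda>a b n. eval_poly A (case_sum a b) (witt_sum p n)) \<rparr>"

section \<open>Coefficient rings\<close>

text \<open>
  A ring together with a structure map from \<open>W(F)\<close> and a reduction map to \<open>F\<close>. The residue
  field and all coefficient rings have their carriers in one type, which serves as the universe
  over which the universal property of a deformation ranges.
\<close>

record 'a calg = "'a ring" +
  str :: "(nat \<Rightarrow> 'a) \<Rightarrow> 'a"
  red :: "'a \<Rightarrow> 'a"

definition max_ideal :: "'a ring \<Rightarrow> 'a calg \<Rightarrow> 'a set" where
  "max_ideal F R = a_kernel R F (red R)"

definition max_ideal_pow :: "'a ring \<Rightarrow> 'a calg \<Rightarrow> nat \<Rightarrow> 'a set" where
  "max_ideal_pow F R n = max_ideal F R [^]\<^bsub>ideals_set R\<^esub> n"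

definition adically_complete :: "'a ring \<Rightarrow> 'a calg \<Rightarrow> bool" where
  "adically_complete F R \<longleftrightarrow>
     (\<Inter>n. max_ideal_pow F R n) = {\<zero>\<^bsub>R\<^esub>} \<and>
     (\<forall>x. (\<forall>n. x n \<in> carrier R \<and> x (Suc n) \<ominus>\<^bsub>R\<^esub> x n \<in> max_ideal_pow F R n) \<longrightarrow>
        (\<exists>y\<in>carrier R. \<forall>n. y \<ominus>\<^bsub>R\<^esub> x n \<in> max_ideal_pow F R n))"

text \<open>
  Complete local Noetherian \<open>W(F)\<close>-algebras with residue field \<open>F\<close>. The last condition says
  that the identification of the residue field with \<open>F\<close> is the one induced by the
  algebra structure, \<open>w 0\<close> being the reduction of \<open>w\<close> modulo \<open>p\<close>.
\<close>

definition coeff_ring :: "nat \<Rightarrow> 'a ring \<Rightarrow> 'a calg \<Rightarrow> bool" where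
  "coeff_ring p F R \<longleftrightarrow>
     cring R \<and> noetherian_ring R \<and> (\<exists>!I. maximalideal I R) \<and>
     red R \<in> ring_hom R F \<and> red R ` carrier R = carrier F \<and>
     adically_complete F R \<and>
     str R \<in> ring_hom (Witt p F) R \<and>
     (\<forall>w\<in>carrier (Witt p F). red R (str R w) = w 0)"

definition residue_calg :: "'a ring \<Rightarrow> 'a calg" where
  "residue_calg F = ring.extend F \<lparr> str = (\<lambda>w. w 0), red = (\<lambda>x. x) \<rparr>"

definition calg_hom :: "nat \<Rightarrow> 'a ring \<Rightarrow> 'a calg \<Rightarrow> 'a calg \<Rightarrow> ('a \<Rightarrow> 'a) set" where
  "calg_hom p F R S = {\<phi> \<in> ring_hom R S \<inter> extensional (carrier R).
     (\<forall>w\<in>carrier (Witt p F). \<phi> (str R w) = str S w) \<and>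
     \<phi> ` max_ideal F R \<subseteq> max_ideal F S}"

definition calg_iso :: "nat \<Rightarrow> 'a ring \<Rightarrow> 'a calg \<Rightarrow> 'a calg \<Rightarrow> bool" where
  "calg_iso p F R S \<longleftrightarrow> (\<exists>\<phi>\<in>calg_hom p F R S. bij_betw \<phi> (carrier R) (carrier S))"

definition adic_topology :: "'a ring \<Rightarrow> 'a calg \<Rightarrow> 'a topology" where
  "adic_topology F R = topology_generated_by (\<Union>n. a_rcosets\<^bsub>R\<^esub> (max_ideal_pow F R n))"

section \<open>Two by two matrices over a ring\<close>

datatype 'a mat2 = Mat2 (m11: 'a) (m12: 'a) (m21: 'a) (m22: 'a)

definition det2 :: "('a, 'b) ring_scheme \<Rightarrow> 'a mat2 \<Rightarrow> 'a" where
  "det2 R A = (m11 A \<otimes>\<^bsub>R\<^esub> m22 A) \<ominus>\<^bsub>R\<^esub> (m12 A \<otimes>\<^bsub>R\<^esub> m21 A)"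

definition tr2 :: "('a, 'b) ring_scheme \<Rightarrow> 'a mat2 \<Rightarrow> 'a" where
  "tr2 R A = m11 A \<oplus>\<^bsub>R\<^esub> m22 A"

definition GL2 :: "('a, 'b) ring_scheme \<Rightarrow> 'a mat2 monoid" where
  "GL2 R = \<lparr> carrier = {A. set_mat2 A \<subseteq> carrier R \<and> det2 R A \<in> Units R},
     monoid.mult = (\<lambda>A B. Mat2
        (m11 A \<otimes>\<^bsub>R\<^esub> m11 B \<oplus>\<^bsub>R\<^esub> m12 A \<otimes>\<^bsub>R\<^esub> m21 B) (m11 A \<otimes>\<^bsub>R\<^esub> m12 B \<oplus>\<^bsub>R\<^esub> m12 A \<otimes>\<^bsub>R\<^esub> m22 B)
        (m21 A \<otimes>\<^bsub>R\<^esub> m11 B \<oplus>\<^bsub>R\<^esub> m22 A \<otimes>\<^bsub>R\<^esub> m21 B) (m21 A \<otimes>\<^bsub>R\<^esub> m12 B \<oplus>\<^bsub>R\<^esub> m22 A \<otimes>\<^bsub>R\<^esub> m22 B)),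
     one = Mat2 \<one>\<^bsub>R\<^esub> \<zero>\<^bsub>R\<^esub> \<zero>\<^bsub>R\<^esub> \<one>\<^bsub>R\<^esub> \<rparr>"

definition mat2_apply :: "('a, 'b) ring_scheme \<Rightarrow> 'a mat2 \<Rightarrow> 'a \<times> 'a \<Rightarrow> 'a \<times> 'a" where
  "mat2_apply R A v = (m11 A \<otimes>\<^bsub>R\<^esub> fst v \<oplus>\<^bsub>R\<^esub> m12 A \<otimes>\<^bsub>R\<^esub> snd v,
                       m21 A \<otimes>\<^bsub>R\<^esub> fst v \<oplus>\<^bsub>R\<^esub> m22 A \<otimes>\<^bsub>R\<^esub> snd v)"

definition plane_subspace :: "('a, 'b) ring_scheme \<Rightarrow> ('a \<times> 'a) set \<Rightarrow> bool" where
  "plane_subspace k V \<longleftrightarrow> V \<subseteq> carrier k \<times> carrier k \<and> (\<zero>\<^bsub>k\<^esub>, \<zero>\<^bsub>k\<^esub>) \<in> V \<and>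
     (\<forall>v\<in>V. \<forall>w\<in>V. (fst v \<oplus>\<^bsub>k\<^esub> fst w, snd v \<oplus>\<^bsub>k\<^esub> snd w) \<in> V) \<and>
     (\<forall>c\<in>carrier k. \<forall>v\<in>V. (c \<otimes>\<^bsub>k\<^esub> fst v, c \<otimes>\<^bsub>k\<^esub> snd v) \<in> V)"

definition irreducible_rep :: "'g set \<Rightarrow> ('a, 'b) ring_scheme \<Rightarrow> ('g \<Rightarrow> 'a mat2) \<Rightarrow> bool" where
  "irreducible_rep G k \<rho> \<longleftrightarrow>
     (\<forall>V. plane_subspace k V \<and> (\<forall>g\<in>G. mat2_apply k (\<rho> g) ` V \<subseteq> V) \<longrightarrow>
        V = {(\<zero>\<^bsub>k\<^esub>, \<zero>\<^bsub>k\<^esub>)} \<or> V = carrier k \<times> carrier k)"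

definition absolutely_irreducible_rep :: "'g set \<Rightarrow> 'a ring \<Rightarrow> ('g \<Rightarrow> 'a mat2) \<Rightarrow> bool" where
  "absolutely_irreducible_rep G F \<rho> \<longleftrightarrow>
     irreducible_rep G (field.alg_closure F) (\<lambda>g. map_mat2 (ring.indexed_const F) (\<rho> g))"

section \<open>Number fields and their Galois groups\<close>

text \<open>Number fields are subfields of the complex numbers.\<close>

abbreviation CC :: "complex ring" where
  "CC \<equiv> ring_of_type_algebra"

definition number_field :: "complex set \<Rightarrow> bool" where
  "number_field K \<longleftrightarrow> subfield K CC \<and> ring.finite_dimension CC \<rat> K"

definition quadratic_extension :: "complex set \<Rightarrow> complex set \<Rightarrow> bool" where
  "quadratic_extension K L \<longleftrightarrow> K \<subseteq> L \<and> subfield L CC \<and> ring.dimension CC 2 K L"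

definition embeddings :: "complex set \<Rightarrow> (complex \<Rightarrow> complex) set" where
  "embeddings K = ring_hom (CC\<lparr>carrier := K\<rparr>) CC \<inter> extensional K"

definition totally_real :: "complex set \<Rightarrow> bool" where
  "totally_real K \<longleftrightarrow> (\<forall>\<sigma>\<in>embeddings K. \<sigma> ` K \<subseteq> \<real>)"

definition totally_positive :: "complex set \<Rightarrow> complex set" where
  "totally_positive K = {x\<in>K. \<forall>\<sigma>\<in>embeddings K. \<sigma> x \<in> \<real> \<and> Re (\<sigma> x) > 0}"

definition Int_ring :: "complex set \<Rightarrow> complex ring" where
  "Int_ring K = CC\<lparr>carrier := {x\<in>K. algebraic_int x}\<rparr>"

definition Qbar :: "complex set" where
  "Qbar = {x. algebraic x}"

definition primes_of :: "complex set \<Rightarrow> complex set set" where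
  "primes_of K = {\<qq>. primeideal \<qq> (Int_ring K) \<and> \<qq> \<noteq> {0}}"

definition ideal_norm :: "complex set \<Rightarrow> complex set \<Rightarrow> nat" where
  "ideal_norm K \<qq> = card (a_rcosets\<^bsub>Int_ring K\<^esub> \<qq>)"

text \<open>
  The automorphisms of \<open>Qbar\<close> over \<open>K\<close>, extended by the identity to all complex numbers.
\<close>

definition Gal :: "complex set \<Rightarrow> (complex \<Rightarrow> complex) monoid" where
  "Gal K = \<lparr> carrier = {\<sigma>. \<sigma> \<in> ring_iso (CC\<lparr>carrier := Qbar\<rparr>) (CC\<lparr>carrier := Qbar\<rparr>) \<and>
                          (\<forall>x\<in>K. \<sigma> x = x) \<and> (\<forall>x. x \<notin> Qbar \<longrightarrow> \<sigma> x = x)},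
     monoid.mult = (\<circ>), one = id \<rparr>"

text \<open>The Krull topology is the topology of pointwise convergence on discrete \<open>Qbar\<close>.\<close>

definition krull_topology :: "complex set \<Rightarrow> (complex \<Rightarrow> complex) topology" where
  "krull_topology K =
     subtopology (product_topology (\<lambda>_. discrete_topology UNIV) UNIV) (carrier (Gal K))"

definition complex_conjugations :: "(complex \<Rightarrow> complex) set" where
  "complex_conjugations =
     {inv\<^bsub>Gal \<rat>\<^esub> \<sigma> \<circ> (\<lambda>x. if x \<in> Qbar then cnj x else x) \<circ> \<sigma> |\<sigma>. \<sigma> \<in> carrier (Gal \<rat>)}"

definition inertia :: "complex set \<Rightarrow> complex set \<Rightarrow> (complex \<Rightarrow> complex) set" where
  "inertia K \<PP> = {\<sigma>\<in>carrier (Gal K). \<forall>x\<in>carrier (Int_ring Qbar). \<sigma> x - x \<in> \<PP>}"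

text \<open>All arithmetic Frobenius elements at \<open>\<qq>\<close>, for all primes of \<open>Qbar\<close> above \<open>\<qq>\<close>.\<close>

definition Frob :: "complex set \<Rightarrow> complex set \<Rightarrow> (complex \<Rightarrow> complex) set" where
  "Frob K \<qq> = {\<sigma>\<in>carrier (Gal K). \<exists>\<PP>. primeideal \<PP> (Int_ring Qbar) \<and> \<PP> \<inter> K = \<qq> \<and>
     (\<forall>x\<in>carrier (Int_ring Qbar). \<sigma> x - x ^ ideal_norm K \<qq> \<in> \<PP>)}"

section \<open>Galois representations and deformations\<close>

definition galois_character ::
    "complex set \<Rightarrow> 'a ring \<Rightarrow> 'a calg \<Rightarrow> ((complex \<Rightarrow> complex) \<Rightarrow> 'a) \<Rightarrow> bool" where
  "galois_character L F R chi \<longleftrightarrow>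
     chi \<in> hom (Gal L) (units_of R) \<and> continuous_map (krull_topology L) (adic_topology F R) chi"

definition galois_rep ::
    "complex set \<Rightarrow> 'a ring \<Rightarrow> 'a calg \<Rightarrow> ((complex \<Rightarrow> complex) \<Rightarrow> 'a mat2) \<Rightarrow> bool" where
  "galois_rep K F R \<rho> \<longleftrightarrow>
     \<rho> \<in> hom (Gal K) (GL2 R) \<and>
     (\<forall>e\<in>{m11, m12, m21, m22}.
        continuous_map (krull_topology K) (adic_topology F R) (\<lambda>g. e (\<rho> g)))"

text \<open>
  The representation of \<open>Gal K\<close> induced from the character \<open>chi\<close> of the subgroup \<open>Gal L\<close> of
  index two, in the basis \<open>1 \<otimes> 1, \<tau> \<otimes> 1\<close>, where \<open>\<tau>\<close> represents the non-trivial coset.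
\<close>

definition induced_rep ::
    "complex set \<Rightarrow> complex set \<Rightarrow> (complex \<Rightarrow> complex) \<Rightarrow> 'a calg \<Rightarrow>
     ((complex \<Rightarrow> complex) \<Rightarrow> 'a) \<Rightarrow> (complex \<Rightarrow> complex) \<Rightarrow> 'a mat2" where
  "induced_rep K L \<tau> R chi g =
     (let \<tau>' = inv\<^bsub>Gal K\<^esub> \<tau>; chi0 = (\<lambda>h. if h \<in> carrier (Gal L) then chi h else \<zero>\<^bsub>R\<^esub>)
      in Mat2 (chi0 g) (chi0 (g \<circ> \<tau>)) (chi0 (\<tau>' \<circ> g)) (chi0 (\<tau>' \<circ> g \<circ> \<tau>)))"

definition totally_odd ::
    "complex set \<Rightarrow> 'a ring \<Rightarrow> ((complex \<Rightarrow> complex) \<Rightarrow> 'a mat2) \<Rightarrow> bool" where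
  "totally_odd K F \<rho> \<longleftrightarrow>
     (\<forall>c\<in>complex_conjugations \<inter> carrier (Gal K). det2 F (\<rho> c) = \<ominus>\<^bsub>F\<^esub> \<one>\<^bsub>F\<^esub>)"

definition unramified_above ::
    "complex set \<Rightarrow> nat \<Rightarrow> 'a calg \<Rightarrow> ((complex \<Rightarrow> complex) \<Rightarrow> 'a mat2) \<Rightarrow> bool" where
  "unramified_above K p R \<rho> \<longleftrightarrow>
     (\<forall>\<PP>. primeideal \<PP> (Int_ring Qbar) \<and> of_nat p \<in> \<PP> \<longrightarrow>
        (\<forall>\<sigma>\<in>inertia K \<PP>. \<rho> \<sigma> = \<one>\<^bsub>GL2 R\<^esub>))"

definition deformation ::
    "complex set \<Rightarrow> 'a ring \<Rightarrow> ((complex \<Rightarrow> complex) \<Rightarrow> 'a mat2) \<Rightarrow>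
     'a calg \<Rightarrow> ((complex \<Rightarrow> complex) \<Rightarrow> 'a mat2) \<Rightarrow> bool" where
  "deformation K F \<rho>bar R \<rho> \<longleftrightarrow>
     galois_rep K F R \<rho> \<and> (\<forall>g\<in>carrier (Gal K). map_mat2 (red R) (\<rho> g) = \<rho>bar g)"

text \<open>Conjugacy by a matrix that reduces to the identity: equality of deformations.\<close>

definition strictly_equivalent ::
    "complex set \<Rightarrow> 'a ring \<Rightarrow> 'a calg \<Rightarrow> ((complex \<Rightarrow> complex) \<Rightarrow> 'a mat2) \<Rightarrow>
     ((complex \<Rightarrow> complex) \<Rightarrow> 'a mat2) \<Rightarrow> bool" where
  "strictly_equivalent K F R \<rho> \<rho>' \<longleftrightarrow>
     (\<exists>U\<in>carrier (GL2 R). map_mat2 (red R) U = \<one>\<^bsub>GL2 F\<^esub> \<and>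
        (\<forall>g\<in>carrier (Gal K). \<rho>' g = U \<otimes>\<^bsub>GL2 R\<^esub> \<rho> g \<otimes>\<^bsub>GL2 R\<^esub> inv\<^bsub>GL2 R\<^esub> U))"

definition deformation_property ::
    "nat \<Rightarrow> 'a ring \<Rightarrow> complex set \<Rightarrow> ((complex \<Rightarrow> complex) \<Rightarrow> 'a mat2) \<Rightarrow>
     ('a calg \<Rightarrow> ((complex \<Rightarrow> complex) \<Rightarrow> 'a mat2) \<Rightarrow> bool) \<Rightarrow> bool" where
  "deformation_property p F K \<rho>bar P \<longleftrightarrow>
     (\<forall>R \<rho> \<rho>'. coeff_ring p F R \<and> deformation K F \<rho>bar R \<rho> \<and> deformation K F \<rho>bar R \<rho>' \<and>
        strictly_equivalent K F R \<rho> \<rho>' \<longrightarrow> P R \<rho> = P R \<rho>') \<and>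
     P (residue_calg F) \<rho>bar"

definition universal_deformation ::
    "nat \<Rightarrow> 'a ring \<Rightarrow> complex set \<Rightarrow> ((complex \<Rightarrow> complex) \<Rightarrow> 'a mat2) \<Rightarrow>
     ('a calg \<Rightarrow> ((complex \<Rightarrow> complex) \<Rightarrow> 'a mat2) \<Rightarrow> bool) \<Rightarrow>
     'a calg \<Rightarrow> ((complex \<Rightarrow> complex) \<Rightarrow> 'a mat2) \<Rightarrow> bool" where
  "universal_deformation p F K \<rho>bar P Runiv \<rho>univ \<longleftrightarrow>
     coeff_ring p F Runiv \<and> deformation K F \<rho>bar Runiv \<rho>univ \<and> P Runiv \<rho>univ \<and>
     (\<forall>R \<rho>. coeff_ring p F R \<and> deformation K F \<rho>bar R \<rho> \<and> P R \<rho> \<longrightarrow>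
        (\<exists>!\<phi>. \<phi> \<in> calg_hom p F Runiv R \<and>
              strictly_equivalent K F R (\<lambda>g. map_mat2 \<phi> (\<rho>univ g)) \<rho>))"

section \<open>Hilbert modular forms\<close>

text \<open>
  Hilbert modular forms over \<open>K\<close> of level \<open>\<Gamma>\<^sub>1(\<nn>)\<close> are functions of pairs \<open>(\<Lambda>, t)\<close>, where
  \<open>\<Lambda>\<close> is an \<open>O\<^sub>K\<close>-lattice in \<open>K \<otimes> \<complex>\<close>, the product of copies of the complex numbers indexed by
  the embeddings of \<open>K\<close>, and \<open>t\<close> is a point of exact order \<open>\<nn>\<close> modulo \<open>\<Lambda>\<close>. Modulo
  homotheties these pairs are the points of
  \<open>GL\<^sub>2(K)\<^sup>+ \ (H\<^sup>d \<times> GL\<^sub>2(A\<^sub>f) / U\<^sub>1(\<nn>))\<close>, with \<open>A\<^sub>f\<close> the finite adeles, \<open>U\<^sub>1(\<nn>)\<close> the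
  matrices whose second row is \<open>(0, 1)\<close> modulo \<open>\<nn>\<close> and \<open>d\<close> the degree of \<open>K\<close>, so all
  narrow ideal classes are covered at once.
\<close>

type_synonym cvec = "(complex \<Rightarrow> complex) \<Rightarrow> complex"
type_synonym form = "cvec set \<Rightarrow> cvec \<Rightarrow> complex"

definition vadd :: "complex set \<Rightarrow> cvec \<Rightarrow> cvec \<Rightarrow> cvec" where
  "vadd K u v = (\<lambda>\<sigma>\<in>embeddings K. u \<sigma> + v \<sigma>)"

definition vmult :: "complex set \<Rightarrow> cvec \<Rightarrow> cvec \<Rightarrow> cvec" where
  "vmult K c u = (\<lambda>\<sigma>\<in>embeddings K. c \<sigma> * u \<sigma>)"

abbreviation (input) emb :: "complex \<Rightarrow> cvec" where
  "emb a \<equiv> (\<lambda>\<sigma>. \<sigma> a)"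

definition lattice_in_plane :: "complex set \<Rightarrow> (complex \<times> complex) set \<Rightarrow> bool" where
  "lattice_in_plane K M \<longleftrightarrow>
     (\<exists>S. finite S \<and> S \<subseteq> K \<times> K \<and>
        M = {(\<Sum>s\<in>S. c s * fst s, \<Sum>s\<in>S. c s * snd s) |c. c ` S \<subseteq> carrier (Int_ring K)}) \<and>
     (\<exists>u\<in>M. \<exists>v\<in>M. fst u * snd v \<noteq> snd u * fst v)"

definition combine :: "complex set \<Rightarrow> cvec \<Rightarrow> cvec \<Rightarrow> complex \<times> complex \<Rightarrow> cvec" where
  "combine K \<omega>1 \<omega>2 m = vadd K (vmult K (emb (fst m)) \<omega>1) (vmult K (emb (snd m)) \<omega>2)"

definition OK_lattice :: "complex set \<Rightarrow> cvec set \<Rightarrow> bool" where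
  "OK_lattice K \<Lambda> \<longleftrightarrow>
     (\<exists>M \<omega>1 \<omega>2. lattice_in_plane K M \<and>
        (\<forall>\<sigma>\<in>embeddings K. Im (\<omega>1 \<sigma> * cnj (\<omega>2 \<sigma>)) \<noteq> 0) \<and> \<Lambda> = combine K \<omega>1 \<omega>2 ` M)"

definition level_pair :: "complex set \<Rightarrow> complex set \<Rightarrow> cvec set \<Rightarrow> cvec \<Rightarrow> bool" where
  "level_pair K \<nn> \<Lambda> t \<longleftrightarrow> OK_lattice K \<Lambda> \<and> t \<in> extensional (embeddings K) \<and>
     {a\<in>carrier (Int_ring K). vmult K (emb a) t \<in> \<Lambda>} = \<nn>"

definition half_planes :: "complex set \<Rightarrow> cvec set" where
  "half_planes K = PiE (embeddings K) (\<lambda>_. {z. Im z > 0})"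

text \<open>Complex differentiability at every point of the product of upper half planes.\<close>

definition holomorphic_on_half_planes :: "complex set \<Rightarrow> (cvec \<Rightarrow> complex) \<Rightarrow> bool" where
  "holomorphic_on_half_planes K f \<longleftrightarrow>
     (\<forall>z\<in>half_planes K. \<exists>D. \<forall>\<epsilon>>0. \<exists>\<delta>>0. \<forall>w\<in>half_planes K.
        (\<forall>\<sigma>\<in>embeddings K. cmod (w \<sigma> - z \<sigma>) < \<delta>) \<longrightarrow>
        cmod (f w - f z - (\<Sum>\<sigma>\<in>embeddings K. D \<sigma> * (w \<sigma> - z \<sigma>)))
          \<le> \<epsilon> * (\<Sum>\<sigma>\<in>embeddings K. cmod (w \<sigma> - z \<sigma>)))"

text \<open>
  The Fourier expansion of a holomorphic form runs over \<open>0\<close> and the totally positive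
  elements; for a cusp form the coefficient at \<open>0\<close> vanishes. Letting \<open>M\<close> range over all
  lattices in the plane \<open>K\<^sup>2\<close>, hence over all translates of one lattice by \<open>GL\<^sub>2(K)\<close>,
  imposes this at all cusps.
\<close>

definition cuspidal_at_infinity :: "complex set \<Rightarrow> (cvec \<Rightarrow> complex) \<Rightarrow> bool" where
  "cuspidal_at_infinity K f \<longleftrightarrow>
     (\<exists>a. \<forall>z\<in>half_planes K.
        ((\<lambda>\<xi>. a \<xi> * exp (2 * of_real pi * \<i> * (\<Sum>\<sigma>\<in>embeddings K. \<sigma> \<xi> * z \<sigma>))) has_sum f z)
          (totally_positive K))"

text \<open>
  Cusp forms of parallel weight \<open>k\<close>. For \<open>m\<close> in the plane, \<open>combine K z (\<lambda>_. 1) m\<close> is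
  \<open>fst m * z + snd m\<close>.
\<close>

definition cusp_forms :: "complex set \<Rightarrow> nat \<Rightarrow> complex set \<Rightarrow> form set" where
  "cusp_forms K k \<nn> = {f.
     (\<forall>\<Lambda> t. \<not> level_pair K \<nn> \<Lambda> t \<longrightarrow> f \<Lambda> t = 0) \<and>
     (\<forall>\<Lambda> t l. level_pair K \<nn> \<Lambda> t \<and> l \<in> \<Lambda> \<longrightarrow> f \<Lambda> (vadd K t l) = f \<Lambda> t) \<and>
     (\<forall>\<Lambda> t c. level_pair K \<nn> \<Lambda> t \<and> (\<forall>\<sigma>\<in>embeddings K. c \<sigma> \<noteq> 0) \<longrightarrow>
        f (vmult K c ` \<Lambda>) (vmult K c t) = inverse ((\<Prod>\<sigma>\<in>embeddings K. c \<sigma>) ^ k) * f \<Lambda> t) \<and>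
     (\<forall>M. \<forall>m\<in>K \<times> K. lattice_in_plane K M \<longrightarrow>
        (let g = (\<lambda>z. f (combine K z (\<lambda>_. 1) ` M) (combine K z (\<lambda>_. 1) m))
         in holomorphic_on_half_planes K g \<and> cuspidal_at_infinity K g))}"

section \<open>Hecke operators\<close>

text \<open>The lattices containing \<open>\<Lambda>\<close> with quotient isomorphic to \<open>O\<^sub>K / \<qq>\<close>.\<close>

definition superlattices :: "complex set \<Rightarrow> complex set \<Rightarrow> cvec set \<Rightarrow> cvec set set" where
  "superlattices K \<qq> \<Lambda> = {\<Lambda>'. OK_lattice K \<Lambda>' \<and> \<Lambda> \<subseteq> \<Lambda>' \<and>
     (\<forall>a\<in>\<qq>. \<forall>u\<in>\<Lambda>'. vmult K (emb a) u \<in> \<Lambda>) \<and>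
     card ((\<lambda>u. vadd K u ` \<Lambda>) ` \<Lambda>') = ideal_norm K \<qq>}"

text \<open>
  The normalisation for which the eigenvalue on a normalised eigenform is its Fourier
  coefficient at \<open>\<qq>\<close>. For rational \<open>K\<close> and \<open>\<qq>\<close> generated by the prime \<open>l\<close>, the lattices containing
  \<open>\<int>z + \<int>\<close> give the usual
  \<open>(T\<^sub>l f)(z) = (\<Sum>j<l. f((z + j) / l)) / l + l\<^sup>k\<^sup>-\<^sup>1 (\<langle>l\<rangle> f)(l z)\<close>.
\<close>

definition hecke_op :: "complex set \<Rightarrow> nat \<Rightarrow> complex set \<Rightarrow> complex set \<Rightarrow> form \<Rightarrow> form" where
  "hecke_op K k \<nn> \<qq> = (\<lambda>f\<in>cusp_forms K k \<nn>. \<lambda>\<Lambda> t.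
     if level_pair K \<nn> \<Lambda> t
     then (\<Sum>\<Lambda>'\<in>superlattices K \<qq> \<Lambda>. f \<Lambda>' t) / of_nat (ideal_norm K \<qq>) else 0)"

definition scalar_op :: "complex set \<Rightarrow> nat \<Rightarrow> complex set \<Rightarrow> complex \<Rightarrow> form \<Rightarrow> form" where
  "scalar_op K k \<nn> c = (\<lambda>f\<in>cusp_forms K k \<nn>. \<lambda>\<Lambda> t. c * f \<Lambda> t)"

definition add_op ::
    "complex set \<Rightarrow> nat \<Rightarrow> complex set \<Rightarrow> (form \<Rightarrow> form) \<Rightarrow> (form \<Rightarrow> form) \<Rightarrow> form \<Rightarrow> form" where
  "add_op K k \<nn> A B = (\<lambda>f\<in>cusp_forms K k \<nn>. \<lambda>\<Lambda> t. A f \<Lambda> t + B f \<Lambda> t)"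

definition good_primes :: "complex set \<Rightarrow> nat \<Rightarrow> complex set \<Rightarrow> complex set set" where
  "good_primes K p \<nn> = {\<qq>\<in>primes_of K. \<not> \<nn> \<subseteq> \<qq> \<and> of_nat p \<notin> \<qq>}"

text \<open>
  An isomorphism of the complex numbers with an algebraic closure of the \<open>p\<close>-adic numbers that
  contains \<open>W(F)\<close>, recorded by the resulting embedding \<open>j\<close> of \<open>W(F)\<close>: the
  complex numbers become an algebraic closure of the fraction field of \<open>W(F)\<close>, which is a
  finite extension of the \<open>p\<close>-adic numbers.
\<close>

definition padic_identification ::
    "nat \<Rightarrow> 'a ring \<Rightarrow> ((nat \<Rightarrow> 'a) \<Rightarrow> complex) \<Rightarrow> bool" where
  "padic_identification p F j \<longleftrightarrow>
     j \<in> ring_hom (Witt p F) CC \<and> inj_on j (carrier (Witt p F)) \<and>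
     algebraic_closure CC {j a / j b |a b. a \<in> carrier (Witt p F) \<and> b \<in> carrier (Witt p F)}"

inductive_set hecke_carrier ::
    "nat \<Rightarrow> 'a ring \<Rightarrow> ((nat \<Rightarrow> 'a) \<Rightarrow> complex) \<Rightarrow> complex set \<Rightarrow> nat \<Rightarrow> complex set \<Rightarrow>
     (form \<Rightarrow> form) set"
  for p F j K k \<nn> where
  scalar: "w \<in> carrier (Witt p F) \<Longrightarrow> scalar_op K k \<nn> (j w) \<in> hecke_carrier p F j K k \<nn>"
| hecke: "\<qq> \<in> good_primes K p \<nn> \<Longrightarrow> hecke_op K k \<nn> \<qq> \<in> hecke_carrier p F j K k \<nn>"
| add: "A \<in> hecke_carrier p F j K k \<nn> \<Longrightarrow> B \<in> hecke_carrier p F j K k \<nn> \<Longrightarrow>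
    add_op K k \<nn> A B \<in> hecke_carrier p F j K k \<nn>"
| mult: "A \<in> hecke_carrier p F j K k \<nn> \<Longrightarrow> B \<in> hecke_carrier p F j K k \<nn> \<Longrightarrow>
    compose (cusp_forms K k \<nn>) A B \<in> hecke_carrier p F j K k \<nn>"

definition hecke_algebra ::
    "nat \<Rightarrow> 'a ring \<Rightarrow> ((nat \<Rightarrow> 'a) \<Rightarrow> complex) \<Rightarrow> complex set \<Rightarrow> nat \<Rightarrow> complex set \<Rightarrow>
     (form \<Rightarrow> form) ring" where
  "hecke_algebra p F j K k \<nn> = \<lparr> carrier = hecke_carrier p F j K k \<nn>,
     monoid.mult = compose (cusp_forms K k \<nn>),
     one = scalar_op K k \<nn> 1,
     ring.zero = scalar_op K k \<nn> 0,
     add = add_op K k \<nn> \<rparr>"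

text \<open>A surjective homomorphism of \<open>W(F)\<close>-algebras from the Hecke algebra onto \<open>T\<close>.\<close>

definition hecke_quotient_map ::
    "nat \<Rightarrow> 'a ring \<Rightarrow> ((nat \<Rightarrow> 'a) \<Rightarrow> complex) \<Rightarrow> complex set \<Rightarrow> nat \<Rightarrow> complex set \<Rightarrow>
     'a calg \<Rightarrow> ((form \<Rightarrow> form) \<Rightarrow> 'a) \<Rightarrow> bool" where
  "hecke_quotient_map p F j K k \<nn> T \<pi> \<longleftrightarrow>
     \<pi> \<in> ring_hom (hecke_algebra p F j K k \<nn>) T \<and>
     \<pi> ` carrier (hecke_algebra p F j K k \<nn>) = carrier T \<and>
     (\<forall>w\<in>carrier (Witt p F). \<pi> (scalar_op K k \<nn> (j w)) = str T w)"

end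

theory Submission
  imports Defs
begin

text \<open>
  Universality gives \<open>\<phi> : Runiv \<rightarrow> Tdih\<close> carrying \<open>\<rho>univ\<close> to \<open>\<rho>dih\<close>. It is surjective, because its
  image contains \<open>W(F)\<close> and the traces of Frobenius elements, that is, the Hecke operators. For
  injectivity consider \<open>\<theta> = \<psi> \<circ> \<phi>\<close>, which fixes \<open>\<rho>univ\<close> up to strict equivalence. If \<open>\<theta>\<close>
  were a morphism of \<open>W(F)\<close>-algebras it would be the identity by uniqueness. But \<open>\<psi>\<close> is only a
  ring homomorphism, so \<open>\<theta>\<close> is local (the kernel of a map to a finite field is maximal) and
  induces a possibly non-trivial automorphism of \<open>F\<close>. Some power \<open>\<theta>\<^sup>n\<close> induces the identity on \<open>F\<close>
  and is then \<open>W(F)\<close>-linear: every Witt vector has the form \<open>u\<^sup>p + p v\<close>, so two homomorphisms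
  from \<open>W(F)\<close> that agree modulo the maximal ideal agree modulo all its powers. Hence
  \<open>\<theta>\<^sup>n\<close> is the identity and \<open>\<phi>\<close> is injective.
\<close>

section \<open>Evaluation of integral polynomials\<close>

abbreviation ZX :: "witt_poly ring" where
  "ZX \<equiv> ring_of_type_algebra"

lemma cring_ZX: "cring ZX"
  by (rule cring_from_type_algebra)

text \<open>Finitely supported functions are finite sums of singles, so identities that are additive
  in a polynomial reduce to a single term.\<close>

lemma poly_mapping_single_add_induct [case_names single add]:
  fixes f :: "'k \<Rightarrow>\<^sub>0 'c::comm_monoid_add"
  assumes single: "\<And>m c. Q (Poly_Mapping.single m c)"
    and add: "\<And>f g. Q f \<Longrightarrow> Q g \<Longrightarrow> Q (f + g)"
  shows "Q f"
proof (induction f rule: Poly_Mapping.update_induct)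
  case const
  \<comment> \<open>The zero function is a single with coefficient 0 at any key, so it needs no case
    of its own.\<close>
  show ?case using single[of undefined 0] by simp
next
  case (update f a b)
  have "Poly_Mapping.update a b f = f + Poly_Mapping.single a b"
    using update(1)
    by (intro poly_mapping_eqI)
       (auto simp: lookup_update lookup_add lookup_single when_def in_keys_iff)
  then show ?case using add single update by simp
qed

context cring
begin

definition monomial_value :: "('v \<Rightarrow> 'a) \<Rightarrow> ('v \<Rightarrow>\<^sub>0 nat) \<Rightarrow> 'a" where
  "monomial_value x m = (\<Otimes>v\<in>Poly_Mapping.keys m. x v [^] Poly_Mapping.lookup m v)"

text \<open>The additional factors are zeroth powers. Two monomials can thus be compared factor by
  factor over the union of their supports.\<close>

lemma monomial_value_superset:
  assumes x: "\<And>v. x v \<in> carrier R" and S: "finite S" "Poly_Mapping.keys m \<subseteq> S"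
  shows "monomial_value x m = (\<Otimes>v\<in>S. x v [^] Poly_Mapping.lookup m v)"
  unfolding monomial_value_def using S x
  by (intro finprod_mono_neutral_cong_left) (auto simp: in_keys_iff)

lemma monomial_value_closed [simp]:
  "(\<And>v. x v \<in> carrier R) \<Longrightarrow> monomial_value x m \<in> carrier R"
  unfolding monomial_value_def by (intro finprod_closed) auto

lemma monomial_value_add:
  assumes x: "\<And>v. x v \<in> carrier R"
  shows "monomial_value x (m + n) = monomial_value x m \<otimes> monomial_value x n"
proof -
  let ?S = "Poly_Mapping.keys m \<union> Poly_Mapping.keys n"
  have "monomial_value x (m + n) =
      (\<Otimes>v\<in>?S. x v [^] Poly_Mapping.lookup m v \<otimes> x v [^] Poly_Mapping.lookup n v)"
    using x Poly_Mapping.keys_add[of m n]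
    by (subst monomial_value_superset[of x ?S])
       (auto simp: lookup_add nat_pow_mult intro!: finprod_cong')
  also have "\<dots> = (\<Otimes>v\<in>?S. x v [^] Poly_Mapping.lookup m v) \<otimes>
      (\<Otimes>v\<in>?S. x v [^] Poly_Mapping.lookup n v)"
    using x by (intro finprod_multf) auto
  also have "\<dots> = monomial_value x m \<otimes> monomial_value x n"
    using x by (subst (1 2) monomial_value_superset[of x ?S]) auto
  finally show ?thesis .
qed

lemma monomial_value_0 [simp]: "monomial_value x 0 = \<one>"
  by (simp add: monomial_value_def)

lemma monomial_value_single:
  "(\<And>v. x v \<in> carrier R) \<Longrightarrow> monomial_value x (Poly_Mapping.single v k) = x v [^] k"
  by (subst monomial_value_superset[of x "{v}"]) auto

lemma witt_eval_superset:
  assumes x: "\<And>v. x v \<in> carrier R" and S: "finite S" "Poly_Mapping.keys f \<subseteq> S"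
  shows "eval_poly R x f = (\<Oplus>m\<in>S. [Poly_Mapping.lookup f m] \<cdot> monomial_value x m)"
  unfolding eval_poly_def monomial_value_def[symmetric] using S x
  by (intro add.finprod_mono_neutral_cong_left) (auto simp: in_keys_iff add_pow_int_ge)

lemma witt_eval_closed [simp]:
  "(\<And>v. x v \<in> carrier R) \<Longrightarrow> eval_poly R x f \<in> carrier R"
  unfolding eval_poly_def monomial_value_def[symmetric] by (intro finsum_closed) auto

lemma witt_eval_add:
  assumes x: "\<And>v. x v \<in> carrier R"
  shows "eval_poly R x (f + g) = eval_poly R x f \<oplus> eval_poly R x g"
proof -
  let ?S = "Poly_Mapping.keys f \<union> Poly_Mapping.keys g"
  have "eval_poly R x (f + g) = (\<Oplus>m\<in>?S. [Poly_Mapping.lookup f m] \<cdot> monomial_value x m \<oplus>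
      [Poly_Mapping.lookup g m] \<cdot> monomial_value x m)"
    using x Poly_Mapping.keys_add[of f g]
    by (subst witt_eval_superset[of x ?S])
       (auto simp: lookup_add add.int_pow_mult intro!: finsum_cong')
  also have "\<dots> = (\<Oplus>m\<in>?S. [Poly_Mapping.lookup f m] \<cdot> monomial_value x m) \<oplus>
      (\<Oplus>m\<in>?S. [Poly_Mapping.lookup g m] \<cdot> monomial_value x m)"
    using x by (intro finsum_addf) auto
  also have "\<dots> = eval_poly R x f \<oplus> eval_poly R x g"
    using x by (subst (1 2) witt_eval_superset[of x ?S]) auto
  finally show ?thesis .
qed

lemma witt_eval_single:
  "(\<And>v. x v \<in> carrier R) \<Longrightarrow>
    eval_poly R x (Poly_Mapping.single m c) = [c] \<cdot> monomial_value x m"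
  by (subst witt_eval_superset[of x "{m}"]) auto

text \<open>Both sides are additive in \<open>f\<close> and in \<open>g\<close>, so a double
  induction leaves the product of two terms, where the integer coefficients are moved out.\<close>

lemma witt_eval_mult:
  assumes x: "\<And>v. x v \<in> carrier R"
  shows "eval_poly R x (f * g) = eval_poly R x f \<otimes> eval_poly R x g"
proof (induction f rule: poly_mapping_single_add_induct)
  case (single m c)
  show ?case
  proof (induction g rule: poly_mapping_single_add_induct)
    case (single n d)
    have "([c] \<cdot> monomial_value x m) \<otimes> ([d] \<cdot> monomial_value x n) =
        [(c * d)] \<cdot> (monomial_value x m \<otimes> monomial_value x n)"
      using x by (simp add: add_pow_ldistr_int add_pow_rdistr_int add.int_pow_pow mult.commute)
    then show ?case
      using x by (simp add: mult_single witt_eval_single monomial_value_add)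
  next
    case (add f g)
    then show ?case
      using x by (simp add: distrib_left witt_eval_add r_distr)
  qed
next
  case (add f g)
  then show ?case
    using x by (simp add: distrib_right witt_eval_add l_distr)
qed

lemma witt_eval_one:
  "(\<And>v. x v \<in> carrier R) \<Longrightarrow> eval_poly R x 1 = \<one>"
  using witt_eval_single[of x 0 1] by simp

lemma witt_eval_ring_hom:
  assumes "\<And>v. x v \<in> carrier R"
  shows "eval_poly R x \<in> ring_hom ZX R"
  using assms
  by (intro ring_hom_memI)
     (auto simp: witt_eval_add witt_eval_mult witt_eval_one ring_of_type_algebra_def)

lemma witt_eval_var [simp]:
  "(\<And>v. x v \<in> carrier R) \<Longrightarrow> eval_poly R x (poly_var v) = x v"
  unfolding poly_var_def by (subst witt_eval_single) (auto simp: monomial_value_single)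

context
  fixes h assumes h: "h \<in> ring_hom ZX R"
begin

lemma ZX_hom_closed [simp]: "h f \<in> carrier R"
  using ring_hom_closed[OF h] by (simp add: ring_of_type_algebra_def)

lemma ZX_hom_add: "h (f + g) = h f \<oplus> h g"
  using ring_hom_add[OF h, of f g] by (simp add: ring_of_type_algebra_def)

lemma ZX_hom_mult: "h (f * g) = h f \<otimes> h g"
  using ring_hom_mult[OF h, of f g] by (simp add: ring_of_type_algebra_def)

lemma ZX_hom_one: "h 1 = \<one>"
  using ring_hom_one[OF h] by (simp add: ring_of_type_algebra_def)

lemma ZX_hom_zero: "h 0 = \<zero>"
  using ZX_hom_add[of 0 0] by (metis ZX_hom_closed add.l_cancel_one add_0)

lemma ZX_hom_uminus: "h (- f) = \<ominus> h f"
  using ZX_hom_add[of "- f" f] by (intro minus_equality[symmetric]) (auto simp: ZX_hom_zero)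

lemma ZX_hom_diff: "h (f - g) = h f \<ominus> h g"
  using ZX_hom_add[of f "- g"] by (simp add: ZX_hom_uminus minus_eq)

lemma ZX_hom_power: "h (f ^ n) = h f [^] n"
  by (induction n) (auto simp: ZX_hom_one ZX_hom_mult m_comm)

lemma ZX_hom_of_nat: "h (of_nat n) = [n] \<cdot> \<one>"
  by (induction n) (auto simp: ZX_hom_zero ZX_hom_one ZX_hom_add a_comm)

end

end

text \<open>The variables generate the polynomials as a ring; 0 arises as 1 + (-1), coefficients as
  signed sums of 1, monomials as products of powers of variables.\<close>

lemma witt_poly_induct [case_names one uminus var add mult]:
  fixes f :: witt_poly
  assumes one: "Q 1" and uminus: "\<And>f. Q f \<Longrightarrow> Q (- f)" and var: "\<And>v. Q (poly_var v)"
    and add: "\<And>f g. Q f \<Longrightarrow> Q g \<Longrightarrow> Q (f + g)" and mult: "\<And>f g. Q f \<Longrightarrow> Q g \<Longrightarrow> Q (f * g)"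
  shows "Q f"
proof (induction f rule: poly_mapping_single_add_induct)
  case (single m c)
  have zero: "Q 0" using add[OF one uminus[OF one]] by simp
  have nat: "Q (of_nat n)" for n by (induction n) (auto intro: zero one add)
  have int: "Q (of_int c)"
    by (cases c rule: int_cases2) (auto intro: nat uminus)
  have power: "Q (poly_var v ^ k)" for v k
    by (induction k) (auto intro: one var mult)
  have pv: "poly_var v ^ k = Poly_Mapping.single (Poly_Mapping.single v k) 1" for v k
    by (induction k) (auto simp: poly_var_def mult_single single_add[symmetric] single_one[symmetric] simp del: single_one)
  have mon: "Q (Poly_Mapping.single m 1)"
  proof (induction m rule: poly_mapping_single_add_induct)
    case (single v k)
    then show ?case using power[of v k] by (simp add: pv)
  next
    case (add m n)
    then show ?case using mult[OF add] by (simp add: mult_single)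
  qed
  have "Poly_Mapping.single m c = of_int c * Poly_Mapping.single m 1"
    by (simp add: single_of_int[symmetric] mult_single del: single_of_int)
  then show ?case using mult[OF int mon] by simp
next
  case (add f g)
  then show ?case by (rule assms(4))
qed

text \<open>Uniqueness half of the universal property of the polynomial ring;
  \<open>witt_eval_ring_hom\<close> and \<open>witt_eval_var\<close> give the existence
  half.\<close>

lemma (in cring) ZX_hom_eqI:
  assumes h: "h \<in> ring_hom ZX R" "h' \<in> ring_hom ZX R"
    and "\<And>v. h (poly_var v) = h' (poly_var v)"
  shows "h f = h' f"
proof (induction f rule: witt_poly_induct)
qed (use assms in \<open>auto simp: ZX_hom_one ZX_hom_uminus ZX_hom_add ZX_hom_mult\<close>)

section \<open>Congruences between powers\<close>

text \<open>In the binomial expansion every coefficient other than the two outer ones is divisible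
  by \<open>p\<close>.\<close>

lemma of_nat_prime_dvd_power_add:
  fixes x y :: "'c::comm_ring_1"
  assumes p: "Factorial_Ring.prime p"
  shows "of_nat p dvd (x + y) ^ p - (x ^ p + y ^ p)"
proof -
  have p0: "p > 0" using p by (simp add: prime_gt_0_nat)
  let ?t = "\<lambda>k. of_nat (p choose k) * x ^ k * y ^ (p - k)"
  have "(x + y) ^ p = (\<Sum>k\<le>p. ?t k)"
    by (rule binomial_ring)
  also have "\<dots> = (\<Sum>k\<in>{0,p}. ?t k) + (\<Sum>k\<in>{..p} - {0,p}. ?t k)"
    by (subst sum.subset_diff[of "{0,p}" "{..p}"]) (auto simp: add.commute)
  also have "(\<Sum>k\<in>{0,p}. ?t k) = x ^ p + y ^ p"
    using p0 by simp
  finally have "(x + y) ^ p - (x ^ p + y ^ p) = (\<Sum>k\<in>{..p} - {0,p}. ?t k)"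
    by simp
  moreover have "of_nat p dvd (\<Sum>k\<in>{..p} - {0,p}. ?t k)"
  proof (rule dvd_sum)
    fix k assume "k \<in> {..p} - {0,p}"
    then have "p dvd (p choose k)" using p by (intro dvd_choose_prime) auto
    then have "(of_nat p :: 'c) dvd of_nat (p choose k)"
      by (auto simp: dvd_def)
    then show "of_nat p dvd ?t k" by (metis dvd_mult2)
  qed
  ultimately show ?thesis by simp
qed

text \<open>In the factorisation of \<open>x ^ p - y ^ p\<close> by \<open>x - y\<close>, the
  cofactor has \<open>p\<close> summands, all congruent to \<open>y ^ (p - 1)\<close> modulo
  \<open>p\<close>. It therefore contributes one further factor \<open>p\<close>.\<close>

lemma of_nat_prime_power_dvd_power_diff_Suc:
  fixes x y :: "'c::comm_ring_1"
  assumes p: "Factorial_Ring.prime p" and xy: "of_nat (p ^ Suc k) dvd x - y"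
  shows "of_nat (p ^ Suc (Suc k)) dvd x ^ p - y ^ p"
proof -
  obtain m where m: "p = Suc m" using p by (metis not0_implies_Suc not_prime_0)
  have "of_nat p dvd x - y"
    using xy by (metis dvd_mult_left of_nat_mult power_Suc)
  have cong: "of_nat p dvd x ^ i - y ^ i" for i
  proof -
    have "x - y dvd x ^ i - y ^ i"
      by (metis dvd_triv_left power_diff_sumr2)
    then show ?thesis using \<open>of_nat p dvd x - y\<close> dvd_trans by blast
  qed
  have "of_nat p dvd (\<Sum>i<p. y ^ (p - Suc i) * x ^ i)"
  proof -
    have "(\<Sum>i<p. y ^ (p - Suc i) * x ^ i) =
        (\<Sum>i<p. y ^ (p - Suc i) * (x ^ i - y ^ i)) + (\<Sum>i<p. y ^ (p - Suc i) * y ^ i)"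
      by (simp add: sum.distrib[symmetric] algebra_simps)
    also have "(\<Sum>i<p. y ^ (p - Suc i) * y ^ i) = of_nat p * y ^ m"
      by (simp add: m power_add[symmetric])
    finally show ?thesis using cong by (auto intro!: dvd_add dvd_sum)
  qed
  then have "of_nat (p ^ Suc k) * of_nat p dvd (x - y) * (\<Sum>i<p. y ^ (p - Suc i) * x ^ i)"
    using xy by (rule mult_dvd_mono[rotated])
  then show ?thesis
    by (simp add: power_diff_sumr2 mult.commute)
qed

lemma of_nat_prime_power_dvd_power_diff:
  fixes x y :: "'c::comm_ring_1"
  assumes p: "Factorial_Ring.prime p" and xy: "of_nat p dvd x - y"
  shows "of_nat (p ^ Suc k) dvd x ^ (p ^ k) - y ^ (p ^ k)"
proof (induction k)
  case 0
  then show ?case using xy by simp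
next
  case (Suc k)
  from of_nat_prime_power_dvd_power_diff_Suc[OF p this] show ?case
    by (simp add: power_mult[symmetric] mult.commute)
qed

section \<open>Witt's theorem\<close>

text \<open>Torsion-freeness of the integral polynomials is what allows equations between ghost
  components to be divided by \<open>p ^ n\<close>.\<close>

lemma witt_poly_of_nat_mult_cancel:
  fixes f g :: witt_poly
  assumes "n > 0" "of_nat n * f = of_nat n * g"
  shows "f = g"
proof -
  have lookup: "Poly_Mapping.lookup (of_nat k * f) m = of_nat k * Poly_Mapping.lookup f m"
    for k m and f :: witt_poly
    by (induction k) (auto simp: lookup_add distrib_right)
  show ?thesis
  proof (rule poly_mapping_eqI)
    fix m
    show "Poly_Mapping.lookup f m = Poly_Mapping.lookup g m"
      using lookup[of n f m] lookup[of n g m] assms by simp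
  qed
qed

section \<open>The integral polynomial ring and its lift of Frobenius\<close>

interpretation ZX: cring ZX
  by (rule cring_ZX)

lemma ZX_simps [simp]:
  "carrier ZX = UNIV" "x \<oplus>\<^bsub>ZX\<^esub> y = x + y" "x \<otimes>\<^bsub>ZX\<^esub> y = x * y" "\<one>\<^bsub>ZX\<^esub> = 1" "\<zero>\<^bsub>ZX\<^esub> = 0"
  by (simp_all add: ring_of_type_algebra_def)

lemma ZX_pow [simp]: "x [^]\<^bsub>ZX\<^esub> (n::nat) = x ^ n"
  by (induction n) (auto simp: mult.commute)

lemma ZX_uminus [simp]: "\<ominus>\<^bsub>ZX\<^esub> x = - x"
  using ZX.minus_equality[of "- x" x] by simp

lemma ZX_minus [simp]: "x \<ominus>\<^bsub>ZX\<^esub> y = x - y"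
  by (simp add: a_minus_def)

text \<open>An endomorphism in characteristic zero lifting the Frobenius modulo \<open>p\<close>, as
  Dwork's criterion for ghost sequences requires.\<close>

definition frob_lift :: "nat \<Rightarrow> witt_poly \<Rightarrow> witt_poly" where
  "frob_lift p = eval_poly ZX (\<lambda>v. poly_var v ^ p)"

lemma frob_lift_hom: "frob_lift p \<in> ring_hom ZX ZX"
  unfolding frob_lift_def by (intro ZX.witt_eval_ring_hom) simp

lemma frob_lift_simps [simp]:
  "frob_lift p (poly_var v) = poly_var v ^ p"
  "frob_lift p (f + g) = frob_lift p f + frob_lift p g"
  "frob_lift p (f - g) = frob_lift p f - frob_lift p g"
  "frob_lift p (f * g) = frob_lift p f * frob_lift p g"
  "frob_lift p (- f) = - frob_lift p f"
  "frob_lift p 1 = 1"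
  using ZX.ZX_hom_add[OF frob_lift_hom] ZX.ZX_hom_diff[OF frob_lift_hom]
    ZX.ZX_hom_mult[OF frob_lift_hom] ZX.ZX_hom_uminus[OF frob_lift_hom]
    ZX.ZX_hom_one[OF frob_lift_hom]
  by (simp_all add: frob_lift_def)

text \<open>Modulo \<open>p\<close> the \<open>p\<close>-th power is additive as well as
  multiplicative, and it agrees with \<open>frob_lift p\<close> on the variables, which
  generate.\<close>

lemma frob_lift_cong:
  assumes p: "Factorial_Ring.prime p"
  shows "of_nat p dvd frob_lift p f - f ^ p"
proof (induction f rule: witt_poly_induct)
  case one
  show ?case by simp
next
  case (uminus f)
  show ?case
  proof (cases "even p")
    case True
    then have p2: "p = 2" using p by (metis prime_odd_nat prime_ge_2_nat le_neq_implies_less)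
    \<comment> \<open>For \<open>p = 2\<close> the sign is lost in the square; the resulting error
      is twice \<open>f ^ p\<close>.\<close>
    have "frob_lift p (- f) - (- f) ^ p = - (frob_lift p f - f ^ p) - of_nat p * f ^ p"
      using True by (simp add: p2)
    then show ?thesis using uminus by (metis dvd_diff dvd_minus_iff dvd_triv_left)
  next
    case False
    then have "frob_lift p (- f) - (- f) ^ p = - (frob_lift p f - f ^ p)"
      by simp
    then show ?thesis using uminus by (metis dvd_minus_iff)
  qed
next
  case (var v)
  show ?case by simp
next
  case (add f g)
  have "frob_lift p (f + g) - (f + g) ^ p =
      (frob_lift p f - f ^ p) + (frob_lift p g - g ^ p) - ((f + g) ^ p - (f ^ p + g ^ p))"
    by simp
  then show ?case
    using add of_nat_prime_dvd_power_add[OF p, of f g] by (metis dvd_add dvd_diff)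
next
  case (mult f g)
  have "frob_lift p (f * g) - (f * g) ^ p =
      (frob_lift p f - f ^ p) * frob_lift p g + f ^ p * (frob_lift p g - g ^ p)"
    by (simp add: algebra_simps power_mult_distrib)
  then show ?case using mult by (metis dvd_add dvd_mult dvd_mult2)
qed

section \<open>Ghost components and the congruences between them\<close>

lemma ghost_hom:
  assumes h: "h \<in> ring_hom ZX ZX"
  shows "h (ghost p Z n) = ghost p (\<lambda>i. h (Z i)) n"
proof -
  have sum: "h (sum f A) = (\<Sum>i\<in>A. h (f i))" for f and A :: "nat set"
    by (induction A rule: infinite_finite_induct)
       (use ZX.ZX_hom_zero[OF h] ZX.ZX_hom_add[OF h] in auto)
  have of_nat: "h (of_nat k) = of_nat k" for k
    by (induction k) (use ZX.ZX_hom_zero[OF h] ZX.ZX_hom_one[OF h] ZX.ZX_hom_add[OF h] in auto)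
  show ?thesis
    using ZX.ZX_hom_mult[OF h] ZX.ZX_hom_power[OF h] of_nat
    by (simp add: ghost_def sum del: of_nat_power)
qed

lemma ghost_cong: "(\<And>i. i \<le> n \<Longrightarrow> a i = b i) \<Longrightarrow> ghost p a n = ghost p b n"
  by (simp add: ghost_def)

lemma ghost_0 [simp]: "ghost p Z 0 = Z 0"
  by (simp add: ghost_def)

text \<open>This isolates the newest coordinate, so it can be solved for once the earlier ones are
  known.\<close>

lemma ghost_Suc:
  "ghost p Z (Suc n) = ghost p (\<lambda>i. Z i ^ p) n + of_nat (p ^ Suc n) * Z (Suc n)"
  by (simp add: ghost_def Suc_diff_le power_mult[symmetric] del: of_nat_power)

text \<open>The term of index \<open>i\<close> carries the factor \<open>p ^ i\<close>, and raising
  to the power \<open>p ^ (n - i)\<close> improves a congruence modulo \<open>p\<close> to one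
  modulo \<open>p ^ Suc (n - i)\<close>; the exponents add up to \<open>Suc n\<close>.\<close>

lemma ghost_diff_dvd:
  assumes p: "Factorial_Ring.prime p" and ab: "\<And>i. i \<le> n \<Longrightarrow> of_nat p dvd a i - b i"
  shows "of_nat (p ^ Suc n) dvd ghost p a n - ghost p b n"
proof -
  have "ghost p a n - ghost p b n =
      (\<Sum>i\<le>n. of_nat (p ^ i) * (a i ^ (p ^ (n - i)) - b i ^ (p ^ (n - i))))"
    by (simp add: ghost_def sum_subtractf right_diff_distrib)
  also have "of_nat (p ^ Suc n) dvd \<dots>"
  proof (rule dvd_sum)
    fix i assume i: "i \<in> {..n}"
    have "p ^ Suc n = p ^ i * p ^ Suc (n - i)"
      using i by (simp flip: power_add)
    then show "(of_nat (p ^ Suc n) :: witt_poly) dvd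
        of_nat (p ^ i) * (a i ^ (p ^ (n - i)) - b i ^ (p ^ (n - i)))"
      unfolding \<open>p ^ Suc n = _\<close> of_nat_mult
      using i ab by (intro mult_dvd_mono of_nat_prime_power_dvd_power_diff[OF p]) auto
  qed
  finally show ?thesis .
qed

lemma ghost_inj:
  assumes p: "p > 0" and eq: "\<And>k. k \<le> n \<Longrightarrow> ghost p a k = ghost p b k"
  shows "a n = b n"
  using eq
proof (induction n rule: less_induct)
  case (less n)
  have low: "a i = b i" if "i < n" for i
    using that by (intro less.IH less.prems) auto
  show ?case
  proof (cases n)
    case 0
    then show ?thesis using less.prems[of 0] by simp
  next
    case (Suc m)
    have "ghost p (\<lambda>i. a i ^ p) m = ghost p (\<lambda>i. b i ^ p) m"
      using low Suc by (intro ghost_cong) auto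
    then have "of_nat (p ^ n) * a n = of_nat (p ^ n) * b n"
      using less.prems[of n] by (simp add: Suc ghost_Suc)
    then show ?thesis
      using p by (intro witt_poly_of_nat_mult_cancel[of "p ^ n" "a n" "b n"]) auto
  qed
qed

text \<open>Dwork's condition for \<open>g\<close> to be the sequence of ghost components of
  integral polynomials. Unlike the ghost formula itself, it visibly passes to sums, differences and
  products.\<close>

definition ghost_compatible :: "nat \<Rightarrow> (nat \<Rightarrow> witt_poly) \<Rightarrow> bool" where
  "ghost_compatible p g \<longleftrightarrow> (\<forall>n. of_nat (p ^ Suc n) dvd g (Suc n) - frob_lift p (g n))"

text \<open>On variables \<open>frob_lift p\<close> is exactly the \<open>p\<close>-th power, so by
  \<open>ghost_Suc\<close> the difference is the last term alone.\<close>

lemma ghost_compatible_vars: "ghost_compatible p (ghost p (\<lambda>i. poly_var (c i)))"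
  unfolding ghost_compatible_def
  by (simp add: ghost_Suc ghost_hom[OF frob_lift_hom] del: of_nat_power)

lemma ghost_compatible_add:
  assumes "ghost_compatible p g" "ghost_compatible p h"
  shows "ghost_compatible p (\<lambda>n. g n + h n)"
  unfolding ghost_compatible_def
proof
  fix n
  have "g (Suc n) + h (Suc n) - frob_lift p (g n + h n) =
      (g (Suc n) - frob_lift p (g n)) + (h (Suc n) - frob_lift p (h n))"
    by simp
  then show "of_nat (p ^ Suc n) dvd g (Suc n) + h (Suc n) - frob_lift p (g n + h n)"
    using assms unfolding ghost_compatible_def by (metis dvd_add)
qed

lemma ghost_compatible_diff:
  assumes "ghost_compatible p g" "ghost_compatible p h"
  shows "ghost_compatible p (\<lambda>n. g n - h n)"
  unfolding ghost_compatible_def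
proof
  fix n
  have "g (Suc n) - h (Suc n) - frob_lift p (g n - h n) =
      (g (Suc n) - frob_lift p (g n)) - (h (Suc n) - frob_lift p (h n))"
    by simp
  then show "of_nat (p ^ Suc n) dvd g (Suc n) - h (Suc n) - frob_lift p (g n - h n)"
    using assms unfolding ghost_compatible_def by (metis dvd_diff)
qed

lemma ghost_compatible_mult:
  assumes "ghost_compatible p g" "ghost_compatible p h"
  shows "ghost_compatible p (\<lambda>n. g n * h n)"
  unfolding ghost_compatible_def
proof
  fix n
  have "g (Suc n) * h (Suc n) - frob_lift p (g n * h n) =
      (g (Suc n) - frob_lift p (g n)) * h (Suc n) +
      frob_lift p (g n) * (h (Suc n) - frob_lift p (h n))"
    by (simp add: algebra_simps)
  then show "of_nat (p ^ Suc n) dvd g (Suc n) * h (Suc n) - frob_lift p (g n * h n)"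
    using assms unfolding ghost_compatible_def by (metis dvd_add dvd_mult dvd_mult2)
qed

text \<open>Coordinates are found one at a time. Since \<open>frob_lift p\<close> is the
  \<open>p\<close>-th power modulo \<open>p\<close>, Dwork's condition makes
  \<open>g (Suc n)\<close> minus the contribution of the known coordinates divisible by
  \<open>p ^ Suc n\<close>.\<close>

lemma ghost_preimage_prefix:
  assumes p: "Factorial_Ring.prime p" and g: "ghost_compatible p g"
  shows "\<exists>S. \<forall>k\<le>n. ghost p S k = g k"
proof (induction n)
  case 0
  show ?case by (intro exI[of _ "\<lambda>_. g 0"]) simp
next
  case (Suc n)
  then obtain S where S: "\<And>k. k \<le> n \<Longrightarrow> ghost p S k = g k" by blast
  have "of_nat (p ^ Suc n) dvd ghost p (\<lambda>i. frob_lift p (S i)) n - ghost p (\<lambda>i. S i ^ p) n"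
    by (intro ghost_diff_dvd p frob_lift_cong)
  moreover have "ghost p (\<lambda>i. frob_lift p (S i)) n = frob_lift p (g n)"
    using S[of n] ghost_hom[OF frob_lift_hom, of p p S n] by simp
  moreover have "of_nat (p ^ Suc n) dvd g (Suc n) - frob_lift p (g n)"
    using g by (simp add: ghost_compatible_def)
  ultimately have "of_nat (p ^ Suc n) dvd
      (g (Suc n) - frob_lift p (g n)) + (frob_lift p (g n) - ghost p (\<lambda>i. S i ^ p) n)"
    by (intro dvd_add) (simp_all only:)
  then have "of_nat (p ^ Suc n) dvd g (Suc n) - ghost p (\<lambda>i. S i ^ p) n"
    by (simp only: diff_add_cancel add_diff_eq)
  then obtain z where z: "g (Suc n) - ghost p (\<lambda>i. S i ^ p) n = of_nat (p ^ Suc n) * z"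
    by (auto simp: dvd_def)
  \<comment> \<open>The quotient \<open>z\<close> is the next coordinate; lower ghost components do
    not see it.\<close>
  let ?T = "S(Suc n := z)"
  have "ghost p ?T k = g k" if "k \<le> Suc n" for k
  proof (cases "k = Suc n")
    case True
    have "ghost p (\<lambda>i. ?T i ^ p) n = ghost p (\<lambda>i. S i ^ p) n"
      by (intro ghost_cong) auto
    then have "ghost p ?T (Suc n) = ghost p (\<lambda>i. S i ^ p) n + of_nat (p ^ Suc n) * z"
      by (subst ghost_Suc) simp
    then show ?thesis using z True by (metis add.commute diff_add_cancel)
  next
    case False
    then have "ghost p ?T k = ghost p S k" using that by (intro ghost_cong) auto
    then show ?thesis using False that S by simp
  qed
  then show ?case by blast
qed

lemma ghost_preimage_unique:
  assumes p: "Factorial_Ring.prime p" and g: "ghost_compatible p g"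
  shows "\<exists>!S. \<forall>n. ghost p S n = g n"
proof -
  have p0: "p > 0" using p by (simp add: prime_gt_0_nat)
  obtain T where T: "\<And>n k. k \<le> n \<Longrightarrow> ghost p (T n) k = g k"
    using ghost_preimage_prefix[OF p g] by metis
  \<comment> \<open>Prefixes of different lengths agree where both are prescribed, by
    \<open>ghost_inj\<close>, so they glue along the diagonal.\<close>
  have "ghost p (\<lambda>i. T i i) n = g n" for n
  proof -
    have "T i i = T n i" if "i \<le> n" for i
      using that by (intro ghost_inj[OF p0, of i "T i" "T n"]) (simp add: T)
    then have "ghost p (\<lambda>i. T i i) n = ghost p (T n) n"
      by (intro ghost_cong)
    then show ?thesis by (simp add: T)
  qed
  moreover have "S = S'" if "\<forall>n. ghost p S n = g n" "\<forall>n. ghost p S' n = g n" for S S'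
    using that by (intro ext ghost_inj[OF p0, of _ S S']) simp
  ultimately show ?thesis by blast
qed

text \<open>Unique existence gives the definite description in \<open>witt_sum\<close> its intended
  meaning.\<close>

lemma ghost_witt_sum:
  assumes p: "Factorial_Ring.prime p"
  shows "ghost p (witt_sum p) n =
    ghost p (\<lambda>i. poly_var (Inl i)) n + ghost p (\<lambda>i. poly_var (Inr i)) n"
  using theI'[OF ghost_preimage_unique[OF p ghost_compatible_add[OF
    ghost_compatible_vars[of p Inl] ghost_compatible_vars[of p Inr]]]]
  unfolding witt_sum_def by blast

lemma ghost_witt_prod:
  assumes p: "Factorial_Ring.prime p"
  shows "ghost p (witt_prod p) n =
    ghost p (\<lambda>i. poly_var (Inl i)) n * ghost p (\<lambda>i. poly_var (Inr i)) n"
  using theI'[OF ghost_preimage_unique[OF p ghost_compatible_mult[OF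
    ghost_compatible_vars[of p Inl] ghost_compatible_vars[of p Inr]]]]
  unfolding witt_prod_def by blast

section \<open>Arithmetic of Witt vectors\<close>

lemma (in cring) ZX_hom_eval_poly:
  assumes h: "h \<in> ring_hom ZX R"
  shows "h (eval_poly ZX x f) = eval_poly R (\<lambda>v. h (x v)) f"
proof -
  have 1: "h \<circ> eval_poly ZX x \<in> ring_hom ZX R"
    using ring_hom_trans[OF ZX.witt_eval_ring_hom h] by simp
  have 2: "eval_poly R (\<lambda>v. h (x v)) \<in> ring_hom ZX R"
    by (intro witt_eval_ring_hom) (simp add: ZX_hom_closed[OF h])
  have "(h \<circ> eval_poly ZX x) f = eval_poly R (\<lambda>v. h (x v)) f"
    by (rule ZX_hom_eqI[OF 1 2]) (simp add: ZX_hom_closed[OF h])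
  then show ?thesis by simp
qed

text \<open>Functoriality carries identities of Witt vectors from \<open>ZX\<close>, where ghost
  components are faithful, to rings with \<open>p\<close>-torsion.\<close>

lemma (in cring) Witt_map_add:
  assumes h: "h \<in> ring_hom ZX R"
  shows "h \<circ> (a \<oplus>\<^bsub>Witt p ZX\<^esub> b) = (h \<circ> a) \<oplus>\<^bsub>Witt p R\<^esub> (h \<circ> b)"
proof -
  have "(\<lambda>v. h (case_sum a b v)) = case_sum (h \<circ> a) (h \<circ> b)"
    by (auto simp: fun_eq_iff split: sum.split)
  then show ?thesis by (simp add: fun_eq_iff Witt_def ZX_hom_eval_poly[OF h])
qed

lemma ghost_Witt_add:
  assumes p: "Factorial_Ring.prime p"
  shows "ghost p (a \<oplus>\<^bsub>Witt p ZX\<^esub> b) n = ghost p a n + ghost p b n"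
proof -
  let ?h = "eval_poly ZX (case_sum a b)"
  have h: "?h \<in> ring_hom ZX ZX" by (intro ZX.witt_eval_ring_hom) simp
  have "ghost p (a \<oplus>\<^bsub>Witt p ZX\<^esub> b) n = ?h (ghost p (witt_sum p) n)"
    by (simp add: Witt_def ghost_hom[OF h])
  also have "\<dots> = ghost p a n + ghost p b n"
    using ZX.ZX_hom_add[OF h] by (simp add: ghost_witt_sum[OF p] ghost_hom[OF h])
  finally show ?thesis .
qed

lemma carrier_Witt [simp]: "a \<in> carrier (Witt p R) \<longleftrightarrow> (\<forall>n. a n \<in> carrier R)"
  by (simp add: Witt_def)

lemma (in cring) Witt_add_closed:
  "a \<in> carrier (Witt p R) \<Longrightarrow> b \<in> carrier (Witt p R) \<Longrightarrow>
    a \<oplus>\<^bsub>Witt p R\<^esub> b \<in> carrier (Witt p R)"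
  unfolding Witt_def by (auto intro!: witt_eval_closed split: sum.split)

lemma (in cring) Witt_mult_closed:
  "a \<in> carrier (Witt p R) \<Longrightarrow> b \<in> carrier (Witt p R) \<Longrightarrow>
    a \<otimes>\<^bsub>Witt p R\<^esub> b \<in> carrier (Witt p R)"
  unfolding Witt_def by (auto intro!: witt_eval_closed split: sum.split)

text \<open>The zeroth ghost component is the zeroth coordinate, so the zeroth product polynomial is
  the product of two variables.\<close>

lemma (in cring) Witt_mult_0:
  assumes p: "Factorial_Ring.prime p"
    and "a \<in> carrier (Witt p R)" "b \<in> carrier (Witt p R)"
  shows "(a \<otimes>\<^bsub>Witt p R\<^esub> b) 0 = a 0 \<otimes> b 0"
proof -
  have x: "case_sum a b v \<in> carrier R" for v
    using assms by (auto split: sum.split)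
  have "witt_prod p 0 = poly_var (Inl 0) * poly_var (Inr 0)"
    using ghost_witt_prod[OF p, of 0] by simp
  then show ?thesis
    using x by (simp add: Witt_def witt_eval_mult)
qed

lemma (in cring) Witt_pow:
  assumes p: "Factorial_Ring.prime p" and u: "u \<in> carrier (Witt p R)"
  shows "u [^]\<^bsub>Witt p R\<^esub> (k::nat) \<in> carrier (Witt p R)"
    and "(u [^]\<^bsub>Witt p R\<^esub> k) 0 = u 0 [^] k"
proof -
  have "u [^]\<^bsub>Witt p R\<^esub> k \<in> carrier (Witt p R) \<and> (u [^]\<^bsub>Witt p R\<^esub> k) 0 = u 0 [^] k"
  proof (induction k)
    case 0
    then show ?case by (simp add: nat_pow_def) (simp add: Witt_def)
  next
    case (Suc k)
    have s: "u [^]\<^bsub>Witt p R\<^esub> Suc k = u [^]\<^bsub>Witt p R\<^esub> k \<otimes>\<^bsub>Witt p R\<^esub> u"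
      by (simp add: nat_pow_def)
    show ?case
      unfolding s using Suc u Witt_mult_closed[of _ p u] Witt_mult_0[OF p _ u] by auto
  qed
  then show "u [^]\<^bsub>Witt p R\<^esub> k \<in> carrier (Witt p R)"
    and "(u [^]\<^bsub>Witt p R\<^esub> k) 0 = u 0 [^] k" by auto
qed

text \<open>Dwork's criterion yields difference polynomials \<open>D\<close>. Over \<open>ZX\<close>
  the sum of \<open>D\<close> and the second generic vector has the ghost components of the first,
  hence equals it; evaluating the variables at \<open>w\<close> and \<open>z\<close> gives the
  claim.\<close>

lemma (in cring) Witt_subtract:
  assumes p: "Factorial_Ring.prime p"
    and w: "w \<in> carrier (Witt p R)" and z: "z \<in> carrier (Witt p R)"
  obtains y where "y \<in> carrier (Witt p R)" "w = y \<oplus>\<^bsub>Witt p R\<^esub> z" "y 0 = w 0 \<ominus> z 0"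
proof -
  have p0: "p > 0" using p by (simp add: prime_gt_0_nat)
  let ?X = "\<lambda>i. poly_var (Inl i)" and ?Y = "\<lambda>i. poly_var (Inr i)"
  obtain D where D: "\<And>n. ghost p D n = ghost p ?X n - ghost p ?Y n"
    using ghost_preimage_unique[OF p ghost_compatible_diff[OF
      ghost_compatible_vars[of p Inl] ghost_compatible_vars[of p Inr]]] by blast
  have "ghost p (D \<oplus>\<^bsub>Witt p ZX\<^esub> ?Y) n = ghost p ?X n" for n
    by (simp add: ghost_Witt_add[OF p] D)
  then have DY: "D \<oplus>\<^bsub>Witt p ZX\<^esub> ?Y = ?X"
    by (intro ext ghost_inj[OF p0, of _ "D \<oplus>\<^bsub>Witt p ZX\<^esub> ?Y" ?X])
  define h where "h = eval_poly R (case_sum w z)"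
  have x: "case_sum w z v \<in> carrier R" for v
    using w z by (auto split: sum.split)
  have h: "h \<in> ring_hom ZX R"
    unfolding h_def using x by (rule witt_eval_ring_hom)
  have hX: "h \<circ> ?X = w" and hY: "h \<circ> ?Y = z"
    using x by (auto simp: fun_eq_iff h_def)
  show thesis
  proof (rule that[of "h \<circ> D"])
    show "h \<circ> D \<in> carrier (Witt p R)" using ZX_hom_closed[OF h] by simp
    show "w = (h \<circ> D) \<oplus>\<^bsub>Witt p R\<^esub> z"
      using Witt_map_add[OF h, of p D ?Y] by (simp only: DY hX hY)
    have "D 0 = ?X 0 - ?Y 0" using D[of 0] by simp
    then show "(h \<circ> D) 0 = w 0 \<ominus> z 0"
      using x ZX_hom_diff[OF h] by (simp add: h_def)
  qed
qed

section \<open>Multiplication by p on Witt vectors\<close>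

text \<open>
  \<open>Witt_multiple p R k v\<close> is \<open>(k + 1) v\<close>; starting at \<open>v\<close> makes the neutrality of the zero
  Witt vector unnecessary.
\<close>

primrec Witt_multiple ::
    "nat \<Rightarrow> ('a, 'b) ring_scheme \<Rightarrow> nat \<Rightarrow> (nat \<Rightarrow> 'a) \<Rightarrow> nat \<Rightarrow> 'a" where
  "Witt_multiple p R 0 v = v"
| "Witt_multiple p R (Suc k) v = Witt_multiple p R k v \<oplus>\<^bsub>Witt p R\<^esub> v"

lemma (in cring) Witt_multiple_closed:
  "v \<in> carrier (Witt p R) \<Longrightarrow> Witt_multiple p R k v \<in> carrier (Witt p R)"
  by (induction k) (auto simp del: carrier_Witt intro: Witt_add_closed)

lemma ghost_Witt_multiple:
  assumes p: "Factorial_Ring.prime p"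
  shows "ghost p (Witt_multiple p ZX k a) n = of_nat (Suc k) * ghost p a n"
  by (induction k) (simp_all add: ghost_Witt_add[OF p] algebra_simps)

lemma (in cring) Witt_map_multiple:
  assumes h: "h \<in> ring_hom ZX R"
  shows "h \<circ> Witt_multiple p ZX k a = Witt_multiple p R k (h \<circ> a)"
proof (induction k)
  case (Suc k)
  then show ?case by (simp only: Witt_multiple.simps Witt_map_add[OF h])
qed simp

text \<open>Replacing \<open>b n\<close> by \<open>a n\<close> makes all coordinates congruent, so
  \<open>ghost_diff_dvd\<close> applies. The two divisibilities differ by
  \<open>of_nat (p ^ n) * (a n - b n)\<close>, from which \<open>p ^ n\<close> is cancelled.\<close>

lemma ghost_diff_dvdD:
  assumes p: "Factorial_Ring.prime p" and ab: "\<And>i. i < n \<Longrightarrow> of_nat p dvd a i - b i"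
    and dvd: "of_nat (p ^ Suc n) dvd ghost p a n - ghost p b n"
  shows "of_nat p dvd a n - b n"
proof -
  have p0: "p > 0" using p by (simp add: prime_gt_0_nat)
  have top: "ghost p Z n = (\<Sum>i<n. of_nat (p ^ i) * Z i ^ (p ^ (n - i))) + of_nat (p ^ n) * Z n" for Z
    by (simp add: ghost_def lessThan_Suc_atMost[symmetric])
  let ?b = "b(n := a n)"
  have "of_nat (p ^ Suc n) dvd ghost p a n - ghost p ?b n"
    using ab by (intro ghost_diff_dvd[OF p]) auto
  with dvd have "of_nat (p ^ Suc n) dvd
      (ghost p a n - ghost p b n) - (ghost p a n - ghost p ?b n)"
    by (rule dvd_diff)
  also have "(ghost p a n - ghost p b n) - (ghost p a n - ghost p ?b n) =
      of_nat (p ^ n) * (a n - b n)"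
    by (simp add: top algebra_simps)
  finally obtain c where "of_nat (p ^ n) * (a n - b n) = of_nat (p ^ Suc n) * c"
    by (auto simp only: dvd_def)
  then have "of_nat (p ^ n) * (a n - b n) = of_nat (p ^ n) * (of_nat p * c)"
    by (simp add: mult_ac)
  then have "a n - b n = of_nat p * c"
    using p0 by (intro witt_poly_of_nat_mult_cancel[of "p ^ n" "a n - b n"]) auto
  then show ?thesis by simp
qed

text \<open>
  In characteristic \<open>p\<close>, multiplication by \<open>p\<close> is the Frobenius followed by the shift: the ghost
  components of \<open>p X\<close> and of \<open>(0, X\<^sub>0\<^sup>p, X\<^sub>1\<^sup>p, \<dots>)\<close> differ by \<open>p\<^sup>n\<^sup>+\<^sup>1 X\<^sub>n\<close>.
\<close>

lemma Witt_multiple_prime_cong: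
  assumes p: "Factorial_Ring.prime p"
  shows "of_nat p dvd Witt_multiple p ZX (p - 1) a n - (case n of 0 \<Rightarrow> 0 | Suc m \<Rightarrow> a m ^ p)"
proof (induction n rule: less_induct)
  case (less n)
  have p0: "p > 0" using p by (simp add: prime_gt_0_nat)
  define V where "V = (\<lambda>n. case n of 0 \<Rightarrow> 0 | Suc m \<Rightarrow> a m ^ p)"
  \<comment> \<open>The term of index 0 vanishes, and the shift turns the weight
    \<open>p ^ i\<close> into \<open>p ^ Suc i\<close>; this is \<open>p\<close> times the ghost
    component of \<open>a\<close> without its last term.\<close>
  have V: "ghost p V n = of_nat p * (\<Sum>i<n. of_nat (p ^ i) * a i ^ (p ^ (n - i)))"
  proof (cases n)
    case (Suc m)
    have "ghost p V (Suc m) = (\<Sum>i\<le>m. of_nat (p ^ Suc i) * (a i ^ p) ^ (p ^ (m - i)))"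
      using p0 by (simp add: ghost_def V_def sum.atMost_Suc_shift zero_power
          del: of_nat_power sum.atMost_Suc)
    also have "\<dots> = of_nat p * (\<Sum>i\<le>m. of_nat (p ^ i) * a i ^ (p ^ (Suc m - i)))"
      by (simp add: sum_distrib_left Suc_diff_le power_mult[symmetric] mult.assoc)
    finally show ?thesis by (simp add: Suc lessThan_Suc_atMost)
  qed (simp add: V_def)
  have "ghost p a n = (\<Sum>i<n. of_nat (p ^ i) * a i ^ (p ^ (n - i))) + of_nat (p ^ n) * a n"
    by (simp add: ghost_def lessThan_Suc_atMost[symmetric])
  then have "ghost p (Witt_multiple p ZX (p - 1) a) n - ghost p V n = of_nat (p ^ Suc n) * a n"
    using p0 by (simp add: ghost_Witt_multiple[OF p] V algebra_simps)
  then have "of_nat (p ^ Suc n) dvd ghost p (Witt_multiple p ZX (p - 1) a) n - ghost p V n"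
    by (metis dvd_triv_left)
  then have "of_nat p dvd Witt_multiple p ZX (p - 1) a n - V n"
    using less.IH
    by (intro ghost_diff_dvdD[OF p, of n "Witt_multiple p ZX (p - 1) a" V]) (auto simp: V_def)
  then show ?case by (simp add: V_def)
qed

lemma (in cring) ZX_hom_dvd:
  assumes h: "h \<in> ring_hom ZX R" and char: "[p] \<cdot> \<one> = \<zero>" and dvd: "of_nat p dvd f - g"
  shows "h f = h g"
proof -
  obtain c where "f = g + of_nat p * c"
    using dvd by (metis dvd_def add.commute diff_add_cancel)
  then show ?thesis
    using ZX_hom_closed[OF h]
    by (simp add: ZX_hom_add[OF h] ZX_hom_mult[OF h] ZX_hom_of_nat[OF h] char)
qed

lemma (in cring) Witt_multiple_prime:
  assumes p: "Factorial_Ring.prime p" and char: "[p] \<cdot> \<one> = \<zero>"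
    and v: "v \<in> carrier (Witt p R)"
  shows "Witt_multiple p R (p - 1) v = (\<lambda>n. case n of 0 \<Rightarrow> \<zero> | Suc m \<Rightarrow> v m [^] p)"
proof
  fix n
  let ?X = "\<lambda>i. poly_var (Inl i)"
  \<comment> \<open>Only the \<open>Inl\<close> variables occur below; the other family merely needs
    values in the ring.\<close>
  define h where "h = eval_poly R (case_sum v v)"
  have x: "case_sum v v i \<in> carrier R" for i
    using v by (auto split: sum.split)
  have h: "h \<in> ring_hom ZX R"
    unfolding h_def using x by (rule witt_eval_ring_hom)
  have hX: "h \<circ> ?X = v"
    using x by (auto simp: fun_eq_iff h_def)
  have "Witt_multiple p R (p - 1) v n = h (Witt_multiple p ZX (p - 1) ?X n)"
    using Witt_map_multiple[OF h, of p "p - 1" ?X] by (metis hX comp_apply)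
  also have "\<dots> = h (case n of 0 \<Rightarrow> 0 | Suc m \<Rightarrow> ?X m ^ p)"
    by (intro ZX_hom_dvd[OF h char] Witt_multiple_prime_cong p)
  also have "\<dots> = (case n of 0 \<Rightarrow> \<zero> | Suc m \<Rightarrow> v m [^] p)"
    using fun_cong[OF hX] by (simp add: ZX_hom_zero[OF h] ZX_hom_power[OF h] split: nat.split)
  finally show "Witt_multiple p R (p - 1) v n = (case n of 0 \<Rightarrow> \<zero> | Suc m \<Rightarrow> v m [^] p)" .
qed

section \<open>Perfectness of finite fields and the decomposition of Witt vectors\<close>

lemma (in cring) power_add_prime_char:
  fixes p :: nat
  assumes p: "Factorial_Ring.prime p" and char: "[p] \<cdot> \<one> = \<zero>"
    and xy: "x \<in> carrier R" "y \<in> carrier R"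
  shows "(x \<oplus> y) [^] p = x [^] p \<oplus> y [^] p"
proof -
  let ?X = "poly_var (Inl 0)" and ?Y = "poly_var (Inr 0)"
  define h where "h = eval_poly R (case_sum (\<lambda>_. x) (\<lambda>_. y))"
  have c: "case_sum (\<lambda>_. x) (\<lambda>_. y) i \<in> carrier R" for i :: "nat + nat"
    using xy by (auto split: sum.split)
  have h: "h \<in> ring_hom ZX R"
    unfolding h_def using c by (rule witt_eval_ring_hom)
  have hX: "h ?X = x" and hY: "h ?Y = y"
    using c by (auto simp: h_def)
  have "h ((?X + ?Y) ^ p) = h (?X ^ p + ?Y ^ p)"
    by (intro ZX_hom_dvd[OF h char] of_nat_prime_dvd_power_add p)
  then show ?thesis
    by (simp add: ZX_hom_add[OF h] ZX_hom_power[OF h] hX hY)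
qed

text \<open>The Frobenius is additive and kills only zero, hence it is injective; finiteness does
  the rest.\<close>

lemma (in field) finite_frobenius_surj:
  fixes p :: nat
  assumes p: "Factorial_Ring.prime p" and char: "[p] \<cdot> \<one> = \<zero>" and fin: "finite (carrier R)"
    and y: "y \<in> carrier R"
  obtains x where "x \<in> carrier R" "x [^] p = y"
proof -
  have "inj_on (\<lambda>x. x [^] p) (carrier R)"
  proof (rule inj_onI)
    fix x z assume xz: "x \<in> carrier R" "z \<in> carrier R" "x [^] p = z [^] p"
    have "z \<oplus> (x \<ominus> z) = x" using xz by algebra
    then have "z [^] p \<oplus> (x \<ominus> z) [^] p = z [^] p"
      using power_add_prime_char[OF p char, of z "x \<ominus> z"] xz by simp
    then have "(x \<ominus> z) [^] p = \<zero>"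
      using xz by (metis add.l_cancel_one minus_closed nat_pow_closed)
    moreover have "a [^] k \<noteq> \<zero>" if "a \<in> carrier R" "a \<noteq> \<zero>" for a and k :: nat
      using that by (induction k) (auto simp: integral_iff)
    ultimately have "x \<ominus> z = \<zero>"
      using xz by blast
    then show "x = z" using xz by simp
  qed
  then have "(\<lambda>x. x [^] p) ` carrier R = carrier R"
    using fin by (intro endo_inj_surj) auto
  then show thesis using y that by (metis (no_types, lifting) imageE)
qed

text \<open>After a suitable \<open>p\<close>-th power is subtracted, the zeroth coordinate
  vanishes. Such a vector is a Frobenius followed by a shift, because coordinates have
  \<open>p\<close>-th roots, and hence is a multiple of \<open>p\<close>.\<close>

lemma (in field) Witt_decompose:
  assumes p: "Factorial_Ring.prime p" and char: "[p] \<cdot> \<one> = \<zero>" and fin: "finite (carrier R)"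
    and w: "w \<in> carrier (Witt p R)"
  obtains u v where "u \<in> carrier (Witt p R)" "v \<in> carrier (Witt p R)"
    "w = Witt_multiple p R (p - 1) v \<oplus>\<^bsub>Witt p R\<^esub> (u [^]\<^bsub>Witt p R\<^esub> p)"
proof -
  have "\<forall>y\<in>carrier R. \<exists>x\<in>carrier R. x [^] p = y"
    using finite_frobenius_surj[OF p char fin] by metis
  then obtain r where r: "\<And>y. y \<in> carrier R \<Longrightarrow> r y \<in> carrier R"
      "\<And>y. y \<in> carrier R \<Longrightarrow> r y [^] p = y"
    by metis
  \<comment> \<open>Only \<open>u 0\<close> matters: it makes the zeroth coordinates of
    \<open>w\<close> and of the \<open>p\<close>-th power of \<open>u\<close> agree.\<close>
  define u where "u = r \<circ> w"
  have u: "u \<in> carrier (Witt p R)" using r w by (simp add: u_def)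
  obtain y where y: "y \<in> carrier (Witt p R)" "w = y \<oplus>\<^bsub>Witt p R\<^esub> (u [^]\<^bsub>Witt p R\<^esub> p)"
      "y 0 = w 0 \<ominus> (u [^]\<^bsub>Witt p R\<^esub> p) 0"
    using Witt_subtract[OF p w Witt_pow(1)[OF p u]] by metis
  have y0: "y 0 = \<zero>"
    using y(3) Witt_pow(2)[OF p u, of p] w r by (simp add: u_def)
  define v where "v = (\<lambda>n. r (y (Suc n)))"
  have v: "v \<in> carrier (Witt p R)" using r y by (simp add: v_def)
  have "Witt_multiple p R (p - 1) v = y"
    unfolding Witt_multiple_prime[OF p char v]
    using y0 r y(1) by (auto simp: fun_eq_iff v_def split: nat.split)
  then show thesis using that u v y(2) by metis
qed

section \<open>Coefficient rings\<close>

text \<open>The binomial expansion cut off after its linear term, all later terms being multiples of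
  \<open>a \<otimes> a\<close>. The exponent \<open>Suc k\<close> avoids a subtraction in the linear
  term.\<close>

lemma (in cring) power_add_mod_ideal:
  assumes J: "ideal J R" and ya: "y \<in> carrier R" "a \<in> carrier R" and aa: "a \<otimes> a \<in> J"
  shows "\<exists>t\<in>J. (y \<oplus> a) [^] Suc k =
    y [^] Suc k \<oplus> ([Suc k] \<cdot> \<one>) \<otimes> (y [^] k \<otimes> a) \<oplus> t"
proof (induction k)
  case 0
  have "\<zero> \<in> J" using J by (simp add: additive_subgroup.zero_closed ideal.axioms(1))
  then show ?case using ya by (intro bexI[of _ \<zero>]) auto
next
  case (Suc k)
  then obtain t where t: "t \<in> J" "(y \<oplus> a) [^] Suc k =
      y [^] Suc k \<oplus> ([Suc k] \<cdot> \<one>) \<otimes> (y [^] k \<otimes> a) \<oplus> t"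
    by blast
  define e c where "e = [Suc k] \<cdot> \<one>" and "c = y [^] k"
  have ec: "e \<in> carrier R" "c \<in> carrier R" using ya by (auto simp: e_def c_def)
  have tR: "t \<in> carrier R" using J t(1) by (rule ideal.Icarr)
  have e': "[Suc (Suc k)] \<cdot> \<one> = e \<oplus> \<one>" by (simp add: e_def)
  have "(y \<oplus> a) [^] Suc (Suc k) = (c \<otimes> y \<oplus> e \<otimes> (c \<otimes> a) \<oplus> t) \<otimes> (y \<oplus> a)"
    using t(2) by (simp add: e_def c_def)
  also have "\<dots> = c \<otimes> y \<otimes> y \<oplus> (e \<oplus> \<one>) \<otimes> (c \<otimes> y \<otimes> a) \<oplus>
      ((e \<otimes> c) \<otimes> (a \<otimes> a) \<oplus> (y \<oplus> a) \<otimes> t)"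
    using ec tR ya by algebra
  also have "\<dots> = y [^] Suc (Suc k) \<oplus> ([Suc (Suc k)] \<cdot> \<one>) \<otimes> (y [^] Suc k \<otimes> a) \<oplus>
      ((e \<otimes> c) \<otimes> (a \<otimes> a) \<oplus> (y \<oplus> a) \<otimes> t)"
    by (simp only: e') (simp add: c_def)
  finally have "(y \<oplus> a) [^] Suc (Suc k) = y [^] Suc (Suc k) \<oplus>
      ([Suc (Suc k)] \<cdot> \<one>) \<otimes> (y [^] Suc k \<otimes> a) \<oplus>
      ((e \<otimes> c) \<otimes> (a \<otimes> a) \<oplus> (y \<oplus> a) \<otimes> t)" .
  moreover have "(e \<otimes> c) \<otimes> (a \<otimes> a) \<oplus> (y \<oplus> a) \<otimes> t \<in> J"
    using ec ya by (intro additive_subgroup.a_closed[OF ideal.axioms(1)[OF J]]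
      ideal.I_l_closed[OF J aa] ideal.I_l_closed[OF J t(1)]) auto
  ultimately show ?case by blast
qed

lemma (in cring) ring_hom_Witt_multiple:
  assumes F: "cring F" and h: "h \<in> ring_hom (Witt p F) R" and v: "v \<in> carrier (Witt p F)"
  shows "h (Witt_multiple p F k v) = ([Suc k] \<cdot> \<one>) \<otimes> h v"
proof (induction k)
  case 0
  then show ?case using ring_hom_closed[OF h v] by simp
next
  case (Suc k)
  have "h (Witt_multiple p F (Suc k) v) = ([Suc k] \<cdot> \<one>) \<otimes> h v \<oplus> h v"
    using ring_hom_add[OF h cring.Witt_multiple_closed[OF F v] v] Suc by simp
  also have "\<dots> = ([Suc k] \<cdot> \<one> \<oplus> \<one>) \<otimes> h v"
    using ring_hom_closed[OF h v] by (simp add: l_distr)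
  finally show ?case by simp
qed

lemma (in cring) ring_hom_Witt_pow:
  assumes F: "cring F" and p: "Factorial_Ring.prime p"
    and h: "h \<in> ring_hom (Witt p F) R" and u: "u \<in> carrier (Witt p F)"
  shows "h (u [^]\<^bsub>Witt p F\<^esub> (k::nat)) = h u [^] k"
proof (induction k)
  case 0
  then show ?case using ring_hom_one[OF h] by (simp add: nat_pow_def)
next
  case (Suc k)
  have "u [^]\<^bsub>Witt p F\<^esub> Suc k = u [^]\<^bsub>Witt p F\<^esub> k \<otimes>\<^bsub>Witt p F\<^esub> u"
    by (simp add: nat_pow_def)
  then show ?case
    using ring_hom_mult[OF h cring.Witt_pow(1)[OF F p u] u] Suc by simp
qed

section \<open>Powers of the maximal ideal and homomorphisms from W(F)\<close>

locale residue_map = cring R + F: field F for R :: "'a calg" (structure) and F :: "'a ring" +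
  assumes red_hom: "red R \<in> ring_hom R F"
begin

lemma red_ring_hom_ring: "ring_hom_ring R F (red R)"
  by (rule ring_hom_ringI2[OF ring_axioms F.ring_axioms red_hom])

lemma max_ideal_iff: "x \<in> max_ideal F R \<longleftrightarrow> x \<in> carrier R \<and> red R x = \<zero>\<^bsub>F\<^esub>"
  by (auto simp: max_ideal_def a_kernel_def')

lemma red_eq_iff:
  assumes "x \<in> carrier R" "y \<in> carrier R"
  shows "red R x = red R y \<longleftrightarrow> x \<ominus> y \<in> max_ideal F R"
proof -
  interpret red: ring_hom_ring R F "red R" by (rule red_ring_hom_ring)
  have "red R (x \<ominus> y) = red R x \<ominus>\<^bsub>F\<^esub> red R y"
    using assms by (simp add: a_minus_def)
  then show ?thesis using assms by (simp add: max_ideal_iff)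
qed

lemma max_ideal_ideal: "ideal (max_ideal F R) R"
  unfolding max_ideal_def by (rule ring_hom_ring.kernel_is_ideal[OF red_ring_hom_ring])

lemma max_ideal_pow_0: "max_ideal_pow F R 0 = carrier R"
  by (simp add: max_ideal_pow_def ideals_set_def nat_pow_def)

lemma max_ideal_pow_Suc:
  "max_ideal_pow F R (Suc n) = ideal_prod R (max_ideal_pow F R n) (max_ideal F R)"
  by (simp add: max_ideal_pow_def ideals_set_def nat_pow_def)

lemma max_ideal_pow_ideal: "ideal (max_ideal_pow F R n) R"
  by (induction n)
     (auto simp: max_ideal_pow_0 max_ideal_pow_Suc
       intro: oneideal ideal_prod_is_ideal max_ideal_ideal)

lemma max_ideal_pow_Suc_subset:
  "max_ideal_pow F R (Suc n) \<subseteq> max_ideal_pow F R n \<inter> max_ideal F R"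
  unfolding max_ideal_pow_Suc
  by (intro ideal_prod_inter max_ideal_pow_ideal max_ideal_ideal)

lemma max_ideal_pow_SucI:
  "a \<in> max_ideal_pow F R n \<Longrightarrow> b \<in> max_ideal F R \<Longrightarrow> a \<otimes> b \<in> max_ideal_pow F R (Suc n)"
  unfolding max_ideal_pow_Suc by (rule ideal_prod.prod)

text \<open>Put \<open>a = x \<ominus> y\<close>. In the expansion of the \<open>p\<close>-th power
  of \<open>y \<oplus> a\<close>, the linear term gains the factor \<open>p\<close>, which lies in
  the maximal ideal, and the rest gains a second factor \<open>a\<close>.\<close>

lemma power_prime_diff_max_ideal_pow:
  fixes p :: nat
  assumes p: "[p] \<cdot> \<one> \<in> max_ideal F R" "p > 0"
    and xy: "x \<in> carrier R" "y \<in> carrier R" "x \<ominus> y \<in> max_ideal_pow F R (Suc n)"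
  shows "x [^] p \<ominus> y [^] p \<in> max_ideal_pow F R (Suc (Suc n))"
proof -
  let ?J = "max_ideal_pow F R (Suc (Suc n))"
  obtain k where k: "p = Suc k" using p(2) by (cases p) auto
  define a where "a = x \<ominus> y"
  have a: "a \<in> carrier R" "a \<in> max_ideal_pow F R (Suc n)" "a \<in> max_ideal F R"
    using xy max_ideal_pow_Suc_subset[of n] by (auto simp: a_def)
  have J: "ideal ?J R" by (rule max_ideal_pow_ideal)
  have x: "x = y \<oplus> a" unfolding a_def using xy by algebra
  obtain t where t: "t \<in> ?J" "x [^] p = y [^] p \<oplus> ([p] \<cdot> \<one>) \<otimes> (y [^] k \<otimes> a) \<oplus> t"
    using power_add_mod_ideal[OF J xy(2) a(1) max_ideal_pow_SucI[OF a(2,3)], of k]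
    unfolding x k by blast
  have pR: "[p] \<cdot> \<one> \<in> carrier R" by simp
  have tR: "t \<in> carrier R" using J t(1) by (rule ideal.Icarr)
  have "x [^] p \<ominus> y [^] p = y [^] k \<otimes> (a \<otimes> ([p] \<cdot> \<one>)) \<oplus> t"
    unfolding t(2) using tR pR a(1) nat_pow_closed[OF xy(2), of k] nat_pow_closed[OF xy(2), of p]
    by algebra
  also have "\<dots> \<in> ?J"
    using xy(2) by (intro additive_subgroup.a_closed[OF ideal.axioms(1)[OF J]] t(1)
      ideal.I_l_closed[OF J max_ideal_pow_SucI[OF a(2) p(1)]]) auto
  finally show ?thesis .
qed

text \<open>For \<open>w\<close> decomposed as \<open>p v\<close> plus the \<open>p\<close>-th power
  of \<open>u\<close>, the difference at \<open>v\<close> is multiplied by \<open>p\<close> and the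
  difference at \<open>u\<close> is improved by the \<open>p\<close>-th power. Each gains one power
  of the maximal ideal.\<close>

lemma Witt_hom_diff_max_ideal_pow:
  assumes p: "Factorial_Ring.prime p" and char: "[p] \<cdot>\<^bsub>F\<^esub> \<one>\<^bsub>F\<^esub> = \<zero>\<^bsub>F\<^esub>"
    and fin: "finite (carrier F)"
    and h: "h \<in> ring_hom (Witt p F) R" and h': "h' \<in> ring_hom (Witt p F) R"
    and red: "\<And>w. w \<in> carrier (Witt p F) \<Longrightarrow> red R (h w) = red R (h' w)"
  shows "w \<in> carrier (Witt p F) \<Longrightarrow> h w \<ominus> h' w \<in> max_ideal_pow F R (Suc n)"
proof (induction n arbitrary: w)
  case 0
  then have hw: "h w \<in> carrier R" "h' w \<in> carrier R"
    using ring_hom_closed[OF h] ring_hom_closed[OF h'] by auto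
  then have "h w \<ominus> h' w \<in> max_ideal F R"
    using red[OF 0] red_eq_iff by simp
  \<comment> \<open>The first power is formed as the product of the unit ideal with the maximal
    ideal, hence the factor one.\<close>
  then have "\<one> \<otimes> (h w \<ominus> h' w) \<in> max_ideal_pow F R (Suc 0)"
    by (intro max_ideal_pow_SucI) (simp_all add: max_ideal_pow_0)
  then show ?case using hw by simp
next
  case (Suc n)
  let ?J = "max_ideal_pow F R (Suc (Suc n))"
  interpret red: ring_hom_ring R F "red R" by (rule red_ring_hom_ring)
  have p0: "p > 0" using p by (simp add: prime_gt_0_nat)
  have J: "ideal ?J R" by (rule max_ideal_pow_ideal)
  have "red R ([k] \<cdot> \<one>) = [k] \<cdot>\<^bsub>F\<^esub> \<one>\<^bsub>F\<^esub>" for k :: nat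
    by (induction k) auto
  then have pm: "[p] \<cdot> \<one> \<in> max_ideal F R" by (simp add: max_ideal_iff char)
  obtain u v where u: "u \<in> carrier (Witt p F)" and v: "v \<in> carrier (Witt p F)"
    and w: "w = Witt_multiple p F (p - 1) v \<oplus>\<^bsub>Witt p F\<^esub> (u [^]\<^bsub>Witt p F\<^esub> p)"
    using F.Witt_decompose[OF p char fin Suc.prems] by metis
  have *: "f w = ([p] \<cdot> \<one>) \<otimes> f v \<oplus> f u [^] p" if f: "f \<in> ring_hom (Witt p F) R" for f
    unfolding w
    using ring_hom_add[OF f F.Witt_multiple_closed[OF v] F.Witt_pow(1)[OF p u]]
      ring_hom_Witt_multiple[OF F.is_cring f v, of "p - 1"] ring_hom_Witt_pow[OF F.is_cring p f u]
    by (simp only: Suc_diff_1[OF p0])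
  have cl: "h u \<in> carrier R" "h' u \<in> carrier R" "h v \<in> carrier R" "h' v \<in> carrier R"
    using ring_hom_closed[OF h] ring_hom_closed[OF h'] u v by auto
  have pR: "[p] \<cdot> \<one> \<in> carrier R" by simp
  have "h w \<ominus> h' w = (h v \<ominus> h' v) \<otimes> ([p] \<cdot> \<one>) \<oplus> (h u [^] p \<ominus> h' u [^] p)"
    unfolding *[OF h] *[OF h']
    using cl pR nat_pow_closed[OF cl(1), of p] nat_pow_closed[OF cl(2), of p] by algebra
  also have "\<dots> \<in> ?J"
  proof (intro additive_subgroup.a_closed ideal.axioms(1) J)
    show "(h v \<ominus> h' v) \<otimes> ([p] \<cdot> \<one>) \<in> ?J"
      using Suc.IH[OF v] pm by (rule max_ideal_pow_SucI)
    show "h u [^] p \<ominus> h' u [^] p \<in> ?J"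
      using Suc.IH[OF u] cl by (intro power_prime_diff_max_ideal_pow[OF pm p0])
  qed
  finally show ?case .
qed

end

lemma coeff_ring_residue_map:
  "coeff_ring p F R \<Longrightarrow> field F \<Longrightarrow> residue_map R F"
  by (simp add: coeff_ring_def residue_map_def residue_map_axioms_def)

text \<open>The difference lies in every power of the maximal ideal, and completeness includes that
  these intersect in zero.\<close>

lemma coeff_ring_Witt_hom_unique:
  assumes R: "coeff_ring p F R" and F: "field F" "finite (carrier F)"
    and p: "Factorial_Ring.prime p" and char: "[p] \<cdot>\<^bsub>F\<^esub> \<one>\<^bsub>F\<^esub> = \<zero>\<^bsub>F\<^esub>"
    and h: "h \<in> ring_hom (Witt p F) R" and h': "h' \<in> ring_hom (Witt p F) R"
    and red: "\<And>w. w \<in> carrier (Witt p F) \<Longrightarrow> red R (h w) = red R (h' w)"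
    and w: "w \<in> carrier (Witt p F)"
  shows "h w = h' w"
proof -
  interpret residue_map R F using R F(1) by (rule coeff_ring_residue_map)
  have cl: "h w \<in> carrier R" "h' w \<in> carrier R"
    using ring_hom_closed[OF h w] ring_hom_closed[OF h' w] by auto
  have "h w \<ominus>\<^bsub>R\<^esub> h' w \<in> max_ideal_pow F R n" for n
  proof (cases n)
    case 0
    then show ?thesis using cl by (simp add: max_ideal_pow_0)
  next
    case (Suc m)
    then show ?thesis using Witt_hom_diff_max_ideal_pow[OF p char F(2) h h' red w] by simp
  qed
  then have "h w \<ominus>\<^bsub>R\<^esub> h' w = \<zero>\<^bsub>R\<^esub>"
    using R by (auto simp: coeff_ring_def adically_complete_def)
  then show ?thesis using cl by simp
qed

section \<open>Locality of ring homomorphisms and their action on the residue field\<close>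

lemma finite_field_kernel_maximal:
  assumes R: "cring R" and F: "field F" "finite (carrier F)" and g: "g \<in> ring_hom R F"
  shows "maximalideal (a_kernel R F g) R"
proof -
  interpret R: cring R by fact
  interpret F: field F by fact
  interpret g: ring_hom_ring R F g
    by (rule ring_hom_ringI2[OF R.ring_axioms F.ring_axioms g])
  have ker: "x \<in> a_kernel R F g \<longleftrightarrow> x \<in> carrier R \<and> g x = \<zero>\<^bsub>F\<^esub>" for x
    unfolding a_kernel_def' by (rule mem_Collect_eq)
  show ?thesis
  proof (rule maximalidealI)
    show "ideal (a_kernel R F g) R" by (rule g.kernel_is_ideal)
    show "carrier R \<noteq> a_kernel R F g"
      using ker[of "\<one>\<^bsub>R\<^esub>"] g.hom_one F.one_not_zero R.one_closed by metis
    fix J assume J: "ideal J R" "a_kernel R F g \<subseteq> J" "J \<subseteq> carrier R"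
    interpret J: ideal J R by fact
    show "J = a_kernel R F g \<or> J = carrier R"
    proof (cases "J \<subseteq> a_kernel R F g")
      case True
      then show ?thesis using J(2) by blast
    next
      case False
      then obtain x where x: "x \<in> J" "x \<in> carrier R" "g x \<noteq> \<zero>\<^bsub>F\<^esub>"
        using J(3) ker by (meson subset_iff)
      have fin: "finite (Units F)"
        using F(2) by (rule finite_subset[rotated]) (simp add: F.field_Units)
      have gx: "g x \<in> Units F" using x by (simp add: F.field_Units)
      have "card (Units F) \<noteq> 0" using fin gx by auto
      \<comment> \<open>The group order is a positive exponent, so the power \<open>z\<close> of
        \<open>x\<close> stays in \<open>J\<close>, while \<open>g z\<close> is one. Thus one is a
        sum of a kernel element and \<open>z\<close>.\<close>
      then obtain k where k: "card (Units F) = Suc k" by (cases "card (Units F)") auto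
      define z where "z = x [^]\<^bsub>R\<^esub> Suc k"
      have z: "z \<in> carrier R" "z \<in> J"
        using x by (simp_all add: z_def J.I_l_closed)
      have "g z = \<one>\<^bsub>F\<^esub>"
        using F.units_power_order_eq_one[OF fin gx] g.hom_nat_pow[OF x(2)] by (simp only: z_def k)
      then have "g (\<one>\<^bsub>R\<^esub> \<ominus>\<^bsub>R\<^esub> z) = \<zero>\<^bsub>F\<^esub>"
        using z(1) by (simp add: a_minus_def F.r_neg)
      then have "\<one>\<^bsub>R\<^esub> \<ominus>\<^bsub>R\<^esub> z \<in> J"
        using z(1) ker J(2) by (meson R.minus_closed R.one_closed subset_iff)
      then have "(\<one>\<^bsub>R\<^esub> \<ominus>\<^bsub>R\<^esub> z) \<oplus>\<^bsub>R\<^esub> z \<in> J"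
        using z(2) by (rule J.a_closed)
      moreover have "(\<one>\<^bsub>R\<^esub> \<ominus>\<^bsub>R\<^esub> z) \<oplus>\<^bsub>R\<^esub> z = \<one>\<^bsub>R\<^esub>"
        using z(1) by (simp add: a_minus_def R.a_assoc R.l_neg)
      ultimately show ?thesis using J.one_imp_carrier by simp
    qed
  qed
qed

text \<open>Composing \<open>f\<close> with the reduction of \<open>S\<close> gives a map to a
  finite field. Its kernel is maximal, and \<open>R\<close> has just one maximal ideal.\<close>

lemma coeff_ring_hom_local:
  assumes R: "coeff_ring p F R" and S: "coeff_ring p F S" and F: "field F" "finite (carrier F)"
    and f: "f \<in> ring_hom R S" and x: "x \<in> carrier R"
  shows "f x \<in> max_ideal F S \<longleftrightarrow> x \<in> max_ideal F R"
proof -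
  interpret R: residue_map R F using R F(1) by (rule coeff_ring_residue_map)
  interpret S: residue_map S F using S F(1) by (rule coeff_ring_residue_map)
  have "maximalideal (a_kernel R F (red S \<circ> f)) R"
    using ring_hom_trans[OF f S.red_hom] by (intro finite_field_kernel_maximal R.is_cring F)
  moreover have "maximalideal (a_kernel R F (red R)) R"
    by (intro finite_field_kernel_maximal R.is_cring F R.red_hom)
  ultimately have eq: "a_kernel R F (red S \<circ> f) = a_kernel R F (red R)"
    using R by (auto simp: coeff_ring_def)
  have "f x \<in> max_ideal F S \<longleftrightarrow> x \<in> a_kernel R F (red S \<circ> f)"
    using x ring_hom_closed[OF f x] by (simp add: S.max_ideal_iff a_kernel_def')
  then show ?thesis by (simp add: eq max_ideal_def)
qed

lemma ring_endo_funpow: "f \<in> ring_hom R R \<Longrightarrow> f ^^ n \<in> ring_hom R R"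
proof (induction n)
  case 0
  show ?case by (auto simp: ring_hom_def)
next
  case (Suc n)
  then show ?case using ring_hom_trans[of "f ^^ n" R R f R] by (simp only: funpow.simps)
qed

text \<open>Locality applied to \<open>x \<ominus> y\<close>: the homomorphism induces a
  well-defined injection on residues.\<close>

lemma coeff_ring_hom_red_eq:
  assumes R: "coeff_ring p F R" and S: "coeff_ring p F S" and F: "field F" "finite (carrier F)"
    and f: "f \<in> ring_hom R S" and xy: "x \<in> carrier R" "y \<in> carrier R"
  shows "red S (f x) = red S (f y) \<longleftrightarrow> red R x = red R y"
proof -
  interpret R: residue_map R F using R F(1) by (rule coeff_ring_residue_map)
  interpret S: residue_map S F using S F(1) by (rule coeff_ring_residue_map)
  interpret f: ring_hom_ring R S f
    by (rule ring_hom_ringI2[OF R.ring_axioms S.ring_axioms f])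
  have "f (x \<ominus>\<^bsub>R\<^esub> y) = f x \<ominus>\<^bsub>S\<^esub> f y"
    using xy f.hom_add[of x "\<ominus>\<^bsub>R\<^esub> y"] f.hom_a_inv[of y] by (simp only: a_minus_def R.a_inv_closed)
  then show ?thesis
    using coeff_ring_hom_local[OF R S F f R.minus_closed[OF xy]]
      R.red_eq_iff[OF xy] S.red_eq_iff[OF f.hom_closed f.hom_closed, OF xy] by metis
qed

text \<open>The map induced on the finite residue field is a permutation and so has finite
  order.\<close>

lemma coeff_ring_endo_power_residually_trivial:
  assumes R: "coeff_ring p F R" and F: "field F" "finite (carrier F)"
    and f: "f \<in> ring_hom R R"
  obtains n where "n > 0" "\<And>x. x \<in> carrier R \<Longrightarrow> red R ((f ^^ n) x) = red R x"
proof -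
  interpret R: residue_map R F using R F(1) by (rule coeff_ring_residue_map)
  have surj: "red R ` carrier R = carrier F" using R by (simp add: coeff_ring_def)
  note red_f = coeff_ring_hom_red_eq[OF R R F f]
  define s where "s = inv_into (carrier R) (red R)"
  have s: "s y \<in> carrier R" "red R (s y) = y" if "y \<in> carrier F" for y
    unfolding s_def using that surj by (metis inv_into_into, metis f_inv_into_f)
  \<comment> \<open>The identity outside the carrier makes this a permutation of the whole type; by
    \<open>red_f\<close> the choice of the section \<open>s\<close> is immaterial.\<close>
  define \<sigma> where "\<sigma> y = (if y \<in> carrier F then red R (f (s y)) else y)" for y
  have red_closed: "red R x \<in> carrier F" if "x \<in> carrier R" for x
    using that surj by blast
  have \<sigma>: "\<sigma> (red R x) = red R (f x)" if "x \<in> carrier R" for x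
    using red_f[OF s(1)[OF red_closed[OF that]] that] s(2)[OF red_closed[OF that]] red_closed[OF that]
    by (simp only: \<sigma>_def if_True)
  have "inj_on \<sigma> (carrier F)"
  proof (rule inj_onI)
    fix y z assume yz: "y \<in> carrier F" "z \<in> carrier F" "\<sigma> y = \<sigma> z"
    then have "red R (f (s y)) = red R (f (s z))" by (simp only: \<sigma>_def if_True)
    then have "red R (s y) = red R (s z)" using red_f[OF s(1) s(1)] yz(1,2) by blast
    then show "y = z" using s(2) yz(1,2) by simp
  qed
  moreover have "\<sigma> ` carrier F \<subseteq> carrier F"
    by (auto simp only: \<sigma>_def if_True intro!: red_closed ring_hom_closed[OF f] s(1))
  ultimately have "bij_betw \<sigma> (carrier F) (carrier F)"
    using endo_inj_surj[OF F(2)] by (intro bij_betw_imageI) blast+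
  then have "\<sigma> permutes carrier F"
    by (rule bij_imp_permutes) (simp only: \<sigma>_def if_False)
  then have "permutation \<sigma>" using F(2) unfolding permutation_permutes by blast
  then obtain n where n: "\<sigma> ^^ n = id" "n > 0" by (rule permutation_is_nilpotent)
  have "red R ((f ^^ k) x) = (\<sigma> ^^ k) (red R x)" if "x \<in> carrier R" for x k
  proof (induction k)
    case (Suc k)
    have "(f ^^ k) x \<in> carrier R"
      using ring_hom_closed[OF ring_endo_funpow[OF f] that] .
    then show ?case using Suc \<sigma>[of "(f ^^ k) x"] by simp
  qed simp
  then show thesis using n by (intro that[of n]) auto
qed

section \<open>Two by two matrices\<close>

lemma GL2_mult: "A \<otimes>\<^bsub>GL2 R\<^esub> B = Mat2
    (m11 A \<otimes>\<^bsub>R\<^esub> m11 B \<oplus>\<^bsub>R\<^esub> m12 A \<otimes>\<^bsub>R\<^esub> m21 B) (m11 A \<otimes>\<^bsub>R\<^esub> m12 B \<oplus>\<^bsub>R\<^esub> m12 A \<otimes>\<^bsub>R\<^esub> m22 B)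
    (m21 A \<otimes>\<^bsub>R\<^esub> m11 B \<oplus>\<^bsub>R\<^esub> m22 A \<otimes>\<^bsub>R\<^esub> m21 B) (m21 A \<otimes>\<^bsub>R\<^esub> m12 B \<oplus>\<^bsub>R\<^esub> m22 A \<otimes>\<^bsub>R\<^esub> m22 B)"
  by (simp add: GL2_def)

lemma GL2_one: "\<one>\<^bsub>GL2 R\<^esub> = Mat2 \<one>\<^bsub>R\<^esub> \<zero>\<^bsub>R\<^esub> \<zero>\<^bsub>R\<^esub> \<one>\<^bsub>R\<^esub>"
  by (simp add: GL2_def)

lemma GL2_carrier: "Mat2 a b c d \<in> carrier (GL2 R) \<longleftrightarrow>
    a \<in> carrier R \<and> b \<in> carrier R \<and> c \<in> carrier R \<and> d \<in> carrier R \<and>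
    a \<otimes>\<^bsub>R\<^esub> d \<ominus>\<^bsub>R\<^esub> b \<otimes>\<^bsub>R\<^esub> c \<in> Units R"
  by (auto simp: GL2_def det2_def)

lemma (in cring) det2_mult:
  assumes "set_mat2 A \<subseteq> carrier R" "set_mat2 B \<subseteq> carrier R"
  shows "det2 R (A \<otimes>\<^bsub>GL2 R\<^esub> B) = det2 R A \<otimes> det2 R B"
proof (cases A; cases B)
  fix a b c d a' b' c' d'
  assume AB: "A = Mat2 a b c d" "B = Mat2 a' b' c' d'"
  then have cl: "a \<in> carrier R" "b \<in> carrier R" "c \<in> carrier R" "d \<in> carrier R"
    "a' \<in> carrier R" "b' \<in> carrier R" "c' \<in> carrier R" "d' \<in> carrier R"
    using assms by auto
  have "(a \<otimes> a' \<oplus> b \<otimes> c') \<otimes> (c \<otimes> b' \<oplus> d \<otimes> d') \<ominus> (a \<otimes> b' \<oplus> b \<otimes> d') \<otimes> (c \<otimes> a' \<oplus> d \<otimes> c') =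
      (a \<otimes> d \<ominus> b \<otimes> c) \<otimes> (a' \<otimes> d' \<ominus> b' \<otimes> c')"
    using cl by algebra
  then show ?thesis by (simp add: AB det2_def GL2_mult)
qed

lemma (in cring) GL2_group: "group (GL2 R)"
proof (rule groupI)
  fix A B assume A: "A \<in> carrier (GL2 R)" and B: "B \<in> carrier (GL2 R)"
  then have AB: "set_mat2 A \<subseteq> carrier R" "set_mat2 B \<subseteq> carrier R"
    "det2 R A \<in> Units R" "det2 R B \<in> Units R"
    by (simp_all add: GL2_def)
  then have "det2 R (A \<otimes>\<^bsub>GL2 R\<^esub> B) \<in> Units R"
    by (simp add: det2_mult)
  moreover have "set_mat2 (A \<otimes>\<^bsub>GL2 R\<^esub> B) \<subseteq> carrier R"
    using AB(1,2) by (cases A; cases B) (auto simp: GL2_mult)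
  ultimately show "A \<otimes>\<^bsub>GL2 R\<^esub> B \<in> carrier (GL2 R)"
    by (simp add: GL2_def)
next
  show "\<one>\<^bsub>GL2 R\<^esub> \<in> carrier (GL2 R)"
    by (simp add: GL2_one GL2_carrier a_minus_def)
next
  fix A B C
  assume "A \<in> carrier (GL2 R)" "B \<in> carrier (GL2 R)" "C \<in> carrier (GL2 R)"
  then show "A \<otimes>\<^bsub>GL2 R\<^esub> B \<otimes>\<^bsub>GL2 R\<^esub> C = A \<otimes>\<^bsub>GL2 R\<^esub> (B \<otimes>\<^bsub>GL2 R\<^esub> C)"
    by (cases A; cases B; cases C)
       (auto simp: GL2_mult GL2_carrier l_distr r_distr m_assoc a_ac)
next
  fix A assume "A \<in> carrier (GL2 R)"
  then show "\<one>\<^bsub>GL2 R\<^esub> \<otimes>\<^bsub>GL2 R\<^esub> A = A"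
    by (cases A) (simp add: GL2_mult GL2_one GL2_carrier)
next
  fix A assume A: "A \<in> carrier (GL2 R)"
  obtain a b c d where Am: "A = Mat2 a b c d" by (cases A)
  define e where "e = inv (a \<otimes> d \<ominus> b \<otimes> c)"
  have cl: "a \<in> carrier R" "b \<in> carrier R" "c \<in> carrier R" "d \<in> carrier R"
    and u: "a \<otimes> d \<ominus> b \<otimes> c \<in> Units R"
    using A by (auto simp: Am GL2_carrier)
  have e: "e \<in> carrier R" "e \<in> Units R" "e \<otimes> (a \<otimes> d \<ominus> b \<otimes> c) = \<one>"
    using u by (auto simp: e_def)
  \<comment> \<open>The adjugate matrix divided by the determinant.\<close>
  let ?B = "Mat2 (e \<otimes> d) (e \<otimes> \<ominus> b) (e \<otimes> \<ominus> c) (e \<otimes> a)"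
  have "e \<otimes> d \<otimes> (e \<otimes> a) \<ominus> e \<otimes> \<ominus> b \<otimes> (e \<otimes> \<ominus> c) = e \<otimes> (e \<otimes> (a \<otimes> d \<ominus> b \<otimes> c))"
    using cl e(1) by algebra
  then have B: "?B \<in> carrier (GL2 R)"
    using cl e by (simp add: GL2_carrier)
  have "e \<otimes> d \<otimes> a \<oplus> e \<otimes> \<ominus> b \<otimes> c = e \<otimes> (a \<otimes> d \<ominus> b \<otimes> c)"
    "e \<otimes> d \<otimes> b \<oplus> e \<otimes> \<ominus> b \<otimes> d = \<zero>"
    "e \<otimes> \<ominus> c \<otimes> a \<oplus> e \<otimes> a \<otimes> c = \<zero>"
    "e \<otimes> \<ominus> c \<otimes> b \<oplus> e \<otimes> a \<otimes> d = e \<otimes> (a \<otimes> d \<ominus> b \<otimes> c)"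
    using cl e(1) by algebra+
  then have "?B \<otimes>\<^bsub>GL2 R\<^esub> A = \<one>\<^bsub>GL2 R\<^esub>"
    by (simp add: GL2_mult GL2_one Am e(3))
  with B show "\<exists>B\<in>carrier (GL2 R). B \<otimes>\<^bsub>GL2 R\<^esub> A = \<one>\<^bsub>GL2 R\<^esub>" by blast
qed

lemma (in cring) tr2_mult_commute:
  assumes "A \<in> carrier (GL2 R)" "B \<in> carrier (GL2 R)"
  shows "tr2 R (A \<otimes>\<^bsub>GL2 R\<^esub> B) = tr2 R (B \<otimes>\<^bsub>GL2 R\<^esub> A)"
  using assms
  by (cases A; cases B) (auto simp: tr2_def GL2_mult GL2_carrier m_comm a_ac)

lemma (in cring) tr2_conjugate:
  assumes U: "U \<in> carrier (GL2 R)" and A: "A \<in> carrier (GL2 R)"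
  shows "tr2 R (U \<otimes>\<^bsub>GL2 R\<^esub> A \<otimes>\<^bsub>GL2 R\<^esub> inv\<^bsub>GL2 R\<^esub> U) = tr2 R A"
proof -
  interpret GL: group "GL2 R" by (rule GL2_group)
  have "tr2 R (U \<otimes>\<^bsub>GL2 R\<^esub> A \<otimes>\<^bsub>GL2 R\<^esub> inv\<^bsub>GL2 R\<^esub> U) =
      tr2 R (inv\<^bsub>GL2 R\<^esub> U \<otimes>\<^bsub>GL2 R\<^esub> (U \<otimes>\<^bsub>GL2 R\<^esub> A))"
    using U A by (intro tr2_mult_commute) auto
  then show ?thesis using U A by (simp add: GL.m_assoc[symmetric])
qed

lemma map_mat2_GL2_hom:
  assumes R: "cring R" and S: "cring S" and f: "f \<in> ring_hom R S"
  shows "map_mat2 f \<in> hom (GL2 R) (GL2 S)"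
proof -
  interpret R: cring R by fact
  interpret S: cring S by fact
  interpret f: ring_hom_ring R S f
    by (rule ring_hom_ringI2[OF R.ring_axioms S.ring_axioms f])
  have unit: "f x \<in> Units S" if x: "x \<in> Units R" for x
  proof -
    have "f (inv\<^bsub>R\<^esub> x) \<otimes>\<^bsub>S\<^esub> f x = \<one>\<^bsub>S\<^esub>"
      using x f.hom_mult[of "inv\<^bsub>R\<^esub> x" x] f.hom_one
        R.Units_l_inv[OF x] R.Units_closed[OF x] R.Units_inv_closed[OF x] by simp
    then show ?thesis
      using R.Units_closed[OF x] R.Units_inv_closed[OF x] S.m_comm
      unfolding Units_def by (auto intro!: bexI[of _ "f (inv\<^bsub>R\<^esub> x)"])
  qed
  show ?thesis
  proof (rule homI)
    fix A assume A: "A \<in> carrier (GL2 R)"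
    obtain a b c d where Am: "A = Mat2 a b c d" by (cases A)
    have cl: "a \<in> carrier R" "b \<in> carrier R" "c \<in> carrier R" "d \<in> carrier R"
      and u: "a \<otimes>\<^bsub>R\<^esub> d \<ominus>\<^bsub>R\<^esub> b \<otimes>\<^bsub>R\<^esub> c \<in> Units R"
      using A by (auto simp: Am GL2_carrier)
    have "f (a \<otimes>\<^bsub>R\<^esub> d \<ominus>\<^bsub>R\<^esub> b \<otimes>\<^bsub>R\<^esub> c) = f a \<otimes>\<^bsub>S\<^esub> f d \<ominus>\<^bsub>S\<^esub> f b \<otimes>\<^bsub>S\<^esub> f c"
      using cl by (simp add: a_minus_def)
    with unit[OF u] show "map_mat2 f A \<in> carrier (GL2 S)"
      using cl by (simp add: Am GL2_carrier)
  next
    fix A B assume "A \<in> carrier (GL2 R)" "B \<in> carrier (GL2 R)"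
    then show "map_mat2 f (A \<otimes>\<^bsub>GL2 R\<^esub> B) = map_mat2 f A \<otimes>\<^bsub>GL2 S\<^esub> map_mat2 f B"
      by (cases A; cases B) (simp add: GL2_mult GL2_carrier)
  qed
qed

lemma tr2_map_mat2:
  assumes f: "f \<in> ring_hom R S" and A: "A \<in> carrier (GL2 R)"
  shows "tr2 S (map_mat2 f A) = f (tr2 R A)"
  using A ring_hom_add[OF f] by (cases A) (simp add: tr2_def GL2_carrier)

section \<open>Strict equivalence of deformations\<close>

lemma deformation_closed:
  "deformation K F \<rho>bar R \<rho> \<Longrightarrow> g \<in> carrier (Gal K) \<Longrightarrow> \<rho> g \<in> carrier (GL2 R)"
  by (auto simp: deformation_def galois_rep_def hom_def)

lemma strictly_equivalent_trans:
  assumes R: "coeff_ring p F R" and F: "field F"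
    and \<rho>: "\<And>g. g \<in> carrier (Gal K) \<Longrightarrow> \<rho> g \<in> carrier (GL2 R)"
    and eq: "strictly_equivalent K F R \<rho> \<rho>'" "strictly_equivalent K F R \<rho>' \<rho>''"
  shows "strictly_equivalent K F R \<rho> \<rho>''"
proof -
  interpret R: residue_map R F using R F by (rule coeff_ring_residue_map)
  interpret GL: group "GL2 R" by (rule R.GL2_group)
  interpret GLF: group "GL2 F" by (rule R.F.GL2_group)
  have red: "map_mat2 (red R) \<in> hom (GL2 R) (GL2 F)"
    by (rule map_mat2_GL2_hom[OF R.is_cring R.F.is_cring R.red_hom])
  obtain U where U: "U \<in> carrier (GL2 R)" "map_mat2 (red R) U = \<one>\<^bsub>GL2 F\<^esub>"
    "\<And>g. g \<in> carrier (Gal K) \<Longrightarrow> \<rho>' g = U \<otimes>\<^bsub>GL2 R\<^esub> \<rho> g \<otimes>\<^bsub>GL2 R\<^esub> inv\<^bsub>GL2 R\<^esub> U"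
    using eq(1) unfolding strictly_equivalent_def by blast
  obtain V where V: "V \<in> carrier (GL2 R)" "map_mat2 (red R) V = \<one>\<^bsub>GL2 F\<^esub>"
    "\<And>g. g \<in> carrier (Gal K) \<Longrightarrow> \<rho>'' g = V \<otimes>\<^bsub>GL2 R\<^esub> \<rho>' g \<otimes>\<^bsub>GL2 R\<^esub> inv\<^bsub>GL2 R\<^esub> V"
    using eq(2) unfolding strictly_equivalent_def by blast
  show ?thesis
    unfolding strictly_equivalent_def
  proof (intro bexI conjI ballI)
    show "V \<otimes>\<^bsub>GL2 R\<^esub> U \<in> carrier (GL2 R)" using U V by simp
    show "map_mat2 (red R) (V \<otimes>\<^bsub>GL2 R\<^esub> U) = \<one>\<^bsub>GL2 F\<^esub>"
      using hom_mult[OF red V(1) U(1)] U(2) V(2) by simp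
    fix g assume g: "g \<in> carrier (Gal K)"
    show "\<rho>'' g = V \<otimes>\<^bsub>GL2 R\<^esub> U \<otimes>\<^bsub>GL2 R\<^esub> \<rho> g \<otimes>\<^bsub>GL2 R\<^esub> inv\<^bsub>GL2 R\<^esub> (V \<otimes>\<^bsub>GL2 R\<^esub> U)"
      unfolding V(3)[OF g] U(3)[OF g] using U(1) V(1) \<rho>[OF g]
      by (simp add: GL.inv_mult_group GL.m_assoc)
  qed
qed

lemma strictly_equivalent_refl:
  assumes R: "coeff_ring p F R" and F: "field F"
    and \<rho>: "\<And>g. g \<in> carrier (Gal K) \<Longrightarrow> \<rho> g \<in> carrier (GL2 R)"
  shows "strictly_equivalent K F R \<rho> \<rho>"
proof -
  interpret R: residue_map R F using R F by (rule coeff_ring_residue_map)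
  interpret GL: group "GL2 R" by (rule R.GL2_group)
  interpret red: ring_hom_ring R F "red R" by (rule R.red_ring_hom_ring)
  show ?thesis
    unfolding strictly_equivalent_def using \<rho>
    by (intro bexI[of _ "\<one>\<^bsub>GL2 R\<^esub>"]) (simp_all, simp add: GL2_one)
qed

text \<open>The map \<open>f\<close> may act non-trivially on the residue field, but it preserves
  the residues 0 and 1, so the image of the conjugating matrix still reduces to the
  identity.\<close>

lemma strictly_equivalent_map:
  assumes R: "coeff_ring p F R" and S: "coeff_ring p F S" and F: "field F" "finite (carrier F)"
    and f: "f \<in> ring_hom R S"
    and \<rho>: "\<And>g. g \<in> carrier (Gal K) \<Longrightarrow> \<rho> g \<in> carrier (GL2 R)"
    and eq: "strictly_equivalent K F R \<rho> \<rho>'"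
  shows "strictly_equivalent K F S (\<lambda>g. map_mat2 f (\<rho> g)) (\<lambda>g. map_mat2 f (\<rho>' g))"
proof -
  interpret R: residue_map R F using R F(1) by (rule coeff_ring_residue_map)
  interpret S: residue_map S F using S F(1) by (rule coeff_ring_residue_map)
  interpret GLR: group "GL2 R" by (rule R.GL2_group)
  interpret GLS: group "GL2 S" by (rule S.GL2_group)
  interpret f: group_hom "GL2 R" "GL2 S" "map_mat2 f"
    by unfold_locales (rule map_mat2_GL2_hom[OF R.is_cring S.is_cring f])
  obtain U where U: "U \<in> carrier (GL2 R)" "map_mat2 (red R) U = \<one>\<^bsub>GL2 F\<^esub>"
    "\<And>g. g \<in> carrier (Gal K) \<Longrightarrow> \<rho>' g = U \<otimes>\<^bsub>GL2 R\<^esub> \<rho> g \<otimes>\<^bsub>GL2 R\<^esub> inv\<^bsub>GL2 R\<^esub> U"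
    using eq unfolding strictly_equivalent_def by blast
  show ?thesis
    unfolding strictly_equivalent_def
  proof (intro bexI conjI ballI)
    show "map_mat2 f U \<in> carrier (GL2 S)" using U(1) by (rule f.hom_closed)
    have one: "red S (f x) = \<one>\<^bsub>F\<^esub>" if "x \<in> carrier R" "red R x = \<one>\<^bsub>F\<^esub>" for x
      using coeff_ring_hom_red_eq[OF R S F f that(1) R.one_closed] that(2)
        ring_hom_one[OF f] ring_hom_one[OF R.red_hom] ring_hom_one[OF S.red_hom] by simp
    have zero: "red S (f x) = \<zero>\<^bsub>F\<^esub>" if "x \<in> carrier R" "red R x = \<zero>\<^bsub>F\<^esub>" for x
      using coeff_ring_hom_local[OF R S F f that(1)] that
      by (simp add: R.max_ideal_iff S.max_ideal_iff)
    show "map_mat2 (red S) (map_mat2 f U) = \<one>\<^bsub>GL2 F\<^esub>"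
      using U(1,2) one zero by (cases U) (simp add: GL2_one GL2_carrier)
    fix g assume g: "g \<in> carrier (Gal K)"
    show "map_mat2 f (\<rho>' g) = map_mat2 f U \<otimes>\<^bsub>GL2 S\<^esub> map_mat2 f (\<rho> g) \<otimes>\<^bsub>GL2 S\<^esub>
        inv\<^bsub>GL2 S\<^esub> map_mat2 f U"
      unfolding U(3)[OF g] using U(1) \<rho>[OF g] by (simp add: f.hom_mult f.hom_inv)
  qed
qed

lemma strictly_equivalent_tr2:
  assumes R: "cring R" and \<rho>: "\<rho> g \<in> carrier (GL2 R)"
    and eq: "strictly_equivalent K F R \<rho> \<rho>'" and g: "g \<in> carrier (Gal K)"
  shows "tr2 R (\<rho>' g) = tr2 R (\<rho> g)"
  using eq g cring.tr2_conjugate[OF R _ \<rho>] unfolding strictly_equivalent_def by metis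

lemma strictly_equivalent_cong:
  assumes "strictly_equivalent K F R \<rho> \<rho>'" "\<And>g. g \<in> carrier (Gal K) \<Longrightarrow> \<sigma> g = \<rho> g"
  shows "strictly_equivalent K F R \<sigma> \<rho>'"
  using assms unfolding strictly_equivalent_def by simp

text \<open>Elements of \<open>calg_hom\<close> are extensional; passing from a ring homomorphism to
  its restriction is invisible on these matrices.\<close>

lemma map_mat2_restrict:
  "A \<in> carrier (GL2 R) \<Longrightarrow> map_mat2 (restrict f (carrier R)) A = map_mat2 f A"
  by (cases A) (simp add: GL2_carrier)

section \<open>From universality to the isomorphism\<close>

text \<open>
  The image contains the structure constants and the Hecke operators, the latter being traces of
  Frobenius elements, and these generate \<open>T\<close> as a ring without taking closures.
\<close>

lemma universal_map_surj:
  assumes T: "cring T" and \<phi>: "\<phi> \<in> calg_hom p F R T"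
    and R: "cring R" "str R \<in> ring_hom (Witt p F) R"
    and \<pi>: "hecke_quotient_map p F j K k \<nn> T \<pi>"
    and tr: "\<forall>\<qq>\<in>good_primes K p \<nn>.
      (\<lambda>\<sigma>. tr2 T (\<rho>' \<sigma>)) ` Frob K \<qq> = {\<pi> (hecke_op K k \<nn> \<qq>)}"
    and \<rho>: "\<And>g. g \<in> carrier (Gal K) \<Longrightarrow> \<rho> g \<in> carrier (GL2 R)"
    and eq: "strictly_equivalent K F T (\<lambda>g. map_mat2 \<phi> (\<rho> g)) \<rho>'"
  shows "\<phi> ` carrier R = carrier T"
proof
  have hom: "\<phi> \<in> ring_hom R T" and str: "\<And>w. w \<in> carrier (Witt p F) \<Longrightarrow> \<phi> (str R w) = str T w"
    using \<phi> by (auto simp: calg_hom_def)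
  have \<pi>_hom: "\<pi> \<in> ring_hom (hecke_algebra p F j K k \<nn>) T"
    and \<pi>_surj: "\<pi> ` hecke_carrier p F j K k \<nn> = carrier T"
    and \<pi>_str: "\<And>w. w \<in> carrier (Witt p F) \<Longrightarrow> \<pi> (scalar_op K k \<nn> (j w)) = str T w"
    using \<pi> by (auto simp: hecke_quotient_map_def hecke_algebra_def)
  show "\<phi> ` carrier R \<subseteq> carrier T"
    using ring_hom_closed[OF hom] by blast
  have "\<pi> A \<in> \<phi> ` carrier R" if "A \<in> hecke_carrier p F j K k \<nn>" for A
    using that
  proof induction
    case (scalar w)
    then show ?case
      using str \<pi>_str ring_hom_closed[OF R(2)] by (metis imageI)
  next
    case (hecke \<qq>)
    \<comment> \<open>The trace condition equates an image of \<open>Frob K \<qq>\<close> with a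
      singleton, so a Frobenius element exists.\<close>
    then obtain \<sigma> where \<sigma>: "\<sigma> \<in> Frob K \<qq>" "tr2 T (\<rho>' \<sigma>) = \<pi> (hecke_op K k \<nn> \<qq>)"
      using tr by (metis (no_types, lifting) imageE insertI1)
    then have g: "\<sigma> \<in> carrier (Gal K)" by (simp add: Frob_def)
    have cl: "map_mat2 \<phi> (\<rho> \<sigma>) \<in> carrier (GL2 T)"
      using map_mat2_GL2_hom[OF R(1) T hom] \<rho>[OF g] by (auto simp: hom_def)
    have "\<pi> (hecke_op K k \<nn> \<qq>) = \<phi> (tr2 R (\<rho> \<sigma>))"
      using strictly_equivalent_tr2[OF T cl eq g] tr2_map_mat2[OF hom \<rho>[OF g]] \<sigma>(2) by simp
    moreover have "tr2 R (\<rho> \<sigma>) \<in> carrier R"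
      using \<rho>[OF g] cring.cring_simprules(1)[OF R(1)]
      by (cases "\<rho> \<sigma>") (auto simp: tr2_def GL2_carrier)
    ultimately show ?case by blast
  next
    case (add A B)
    then obtain x y where xy: "x \<in> carrier R" "y \<in> carrier R" "\<pi> A = \<phi> x" "\<pi> B = \<phi> y" by blast
    have "\<pi> (add_op K k \<nn> A B) = \<phi> (x \<oplus>\<^bsub>R\<^esub> y)"
      using ring_hom_add[OF \<pi>_hom, of A B] ring_hom_add[OF hom xy(1,2)] add.hyps xy
      by (simp add: hecke_algebra_def)
    then show ?case using xy cring.cring_simprules(1)[OF R(1)] by blast
  next
    case (mult A B)
    then obtain x y where xy: "x \<in> carrier R" "y \<in> carrier R" "\<pi> A = \<phi> x" "\<pi> B = \<phi> y" by blast
    have "\<pi> (compose (cusp_forms K k \<nn>) A B) = \<phi> (x \<otimes>\<^bsub>R\<^esub> y)"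
      using ring_hom_mult[OF \<pi>_hom, of A B] ring_hom_mult[OF hom xy(1,2)] mult.hyps xy
      by (simp add: hecke_algebra_def)
    then show ?case using xy cring.cring_simprules(5)[OF R(1)] by blast
  qed
  then show "carrier T \<subseteq> \<phi> ` carrier R" using \<pi>_surj by (metis image_subsetI)
qed

text \<open>
  An endomorphism fixing the universal deformation up to strict equivalence need not be linear
  over \<open>W(F)\<close>, because \<open>F\<close> may be larger than the field generated by the traces of \<open>\<rho>bar\<close>;
  but a power of it is linear and hence the identity.
\<close>

lemma universal_deformation_endo_inj:
  assumes univ: "universal_deformation p F K \<rho>bar P R \<rho>"
    and F: "field F" "finite (carrier F)"
    and p: "Factorial_Ring.prime p" and char: "[p] \<cdot>\<^bsub>F\<^esub> \<one>\<^bsub>F\<^esub> = \<zero>\<^bsub>F\<^esub>"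
    and \<theta>: "\<theta> \<in> ring_hom R R"
    and eq: "strictly_equivalent K F R (\<lambda>g. map_mat2 \<theta> (\<rho> g)) \<rho>"
  shows "inj_on \<theta> (carrier R)"
proof -
  have R: "coeff_ring p F R" and def: "deformation K F \<rho>bar R \<rho>" and P: "P R \<rho>"
    and uniq: "\<And>R' \<rho>'. coeff_ring p F R' \<Longrightarrow> deformation K F \<rho>bar R' \<rho>' \<Longrightarrow> P R' \<rho>' \<Longrightarrow>
      \<exists>!\<phi>. \<phi> \<in> calg_hom p F R R' \<and> strictly_equivalent K F R' (\<lambda>g. map_mat2 \<phi> (\<rho> g)) \<rho>'"
    using univ unfolding universal_deformation_def by blast+
  interpret R: residue_map R F using R F(1) by (rule coeff_ring_residue_map)
  note \<rho> = deformation_closed[OF def]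
  have str: "str R \<in> ring_hom (Witt p F) R" using R by (simp add: coeff_ring_def)
  have hom: "\<theta> ^^ n \<in> ring_hom R R" for n
    using \<theta> by (rule ring_endo_funpow)
  have \<rho>n: "map_mat2 f (\<rho> g) \<in> carrier (GL2 R)"
    if "f \<in> ring_hom R R" "g \<in> carrier (Gal K)" for f g
    using map_mat2_GL2_hom[OF R.is_cring R.is_cring that(1)] \<rho>[OF that(2)] by (auto simp: hom_def)
  \<comment> \<open>Apply \<open>\<theta>\<close> to the equivalence for \<open>n\<close>, then
    continue with the given one for \<open>\<theta>\<close>.\<close>
  have eqn: "strictly_equivalent K F R (\<lambda>g. map_mat2 (\<theta> ^^ n) (\<rho> g)) \<rho>" for n
  proof (induction n)
    case 0
    show ?case
      by (rule strictly_equivalent_cong[OF strictly_equivalent_refl[OF R F(1) \<rho>]])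
         (simp_all add: mat2.map_id[unfolded id_def])
  next
    case (Suc n)
    have 1: "strictly_equivalent K F R (\<lambda>g. map_mat2 \<theta> (map_mat2 (\<theta> ^^ n) (\<rho> g)))
        (\<lambda>g. map_mat2 \<theta> (\<rho> g))"
      by (rule strictly_equivalent_map[OF R R F \<theta> _ Suc]) (rule \<rho>n[OF hom])
    have "strictly_equivalent K F R (\<lambda>g. map_mat2 \<theta> (map_mat2 (\<theta> ^^ n) (\<rho> g))) \<rho>"
    proof (rule strictly_equivalent_trans[OF R F(1) _ 1 eq])
      fix g assume "g \<in> carrier (Gal K)"
      then show "map_mat2 \<theta> (map_mat2 (\<theta> ^^ n) (\<rho> g)) \<in> carrier (GL2 R)"
        using map_mat2_GL2_hom[OF R.is_cring R.is_cring \<theta>] \<rho>n[OF hom] by (auto simp: hom_def)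
    qed
    then show ?case by (simp add: mat2.map_comp comp_def)
  qed
  obtain n where n: "n > 0" and red: "\<And>x. x \<in> carrier R \<Longrightarrow> red R ((\<theta> ^^ n) x) = red R x"
    using coeff_ring_endo_power_residually_trivial[OF R F \<theta>] by metis
  \<comment> \<open>A residually trivial endomorphism is linear over W(F), since
    \<open>f \<circ> str R\<close> and \<open>str R\<close> have the same reduction.\<close>
  have calg: "restrict f (carrier R) \<in> calg_hom p F R R"
      "strictly_equivalent K F R (\<lambda>g. map_mat2 (restrict f (carrier R)) (\<rho> g)) \<rho>"
    if f: "f \<in> ring_hom R R" and red: "\<And>x. x \<in> carrier R \<Longrightarrow> red R (f x) = red R x"
      and eq: "strictly_equivalent K F R (\<lambda>g. map_mat2 f (\<rho> g)) \<rho>" for f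
  proof -
    have "restrict f (carrier R) \<in> ring_hom R R"
      using f by (auto simp: ring_hom_def)
    moreover have "f (str R w) = str R w" if w: "w \<in> carrier (Witt p F)" for w
    proof -
      have "(f \<circ> str R) w = str R w"
        by (rule coeff_ring_Witt_hom_unique[OF R F p char ring_hom_trans[OF str f] str _ w])
           (simp only: comp_apply red ring_hom_closed[OF str])
      then show ?thesis by simp
    qed
    ultimately show "restrict f (carrier R) \<in> calg_hom p F R R"
      using red ring_hom_closed[OF str] ring_hom_closed[OF f]
      by (auto simp: calg_hom_def R.max_ideal_iff)
    show "strictly_equivalent K F R (\<lambda>g. map_mat2 (restrict f (carrier R)) (\<rho> g)) \<rho>"
      using eq by (rule strictly_equivalent_cong) (simp add: map_mat2_restrict \<rho>)
  qed
  \<comment> \<open>The universal property is applied to \<open>\<rho>\<close> itself, where the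
    identity, written as the zeroth iterate, is a competing morphism.\<close>
  have id: "restrict (\<theta> ^^ n) (carrier R) = restrict (\<theta> ^^ 0) (carrier R)"
    using uniq[OF R def P] calg[OF hom red eqn] calg[OF hom _ eqn, of 0] by auto
  show ?thesis
  proof (rule inj_onI)
    fix x y assume xy: "x \<in> carrier R" "y \<in> carrier R" "\<theta> x = \<theta> y"
    obtain m where m: "n = Suc m" using n by (cases n) auto
    have "(\<theta> ^^ n) x = (\<theta> ^^ n) y"
      using xy(3) by (simp add: m funpow_Suc_right del: funpow.simps)
    moreover have "(\<theta> ^^ n) z = z" if "z \<in> carrier R" for z
      using fun_cong[OF id, of z] that by simp
    ultimately show "x = y" using xy by simp
  qed
qed

theorem theorem4p3:
  fixes p :: nat and F :: "'a ring"
    and K L :: "complex set" and \<tau> :: "complex \<Rightarrow> complex"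
    and chibar :: "(complex \<Rightarrow> complex) \<Rightarrow> 'a"
    and \<rho>bar :: "(complex \<Rightarrow> complex) \<Rightarrow> 'a mat2"
    and j :: "(nat \<Rightarrow> 'a) \<Rightarrow> complex"
    and P :: "'a calg \<Rightarrow> ((complex \<Rightarrow> complex) \<Rightarrow> 'a mat2) \<Rightarrow> bool"
    and Runiv :: "'a calg" and \<rho>univ :: "(complex \<Rightarrow> complex) \<Rightarrow> 'a mat2"
    and chi :: "(complex \<Rightarrow> complex) \<Rightarrow> 'a"
    and \<nn> :: "complex set"
    and Tdih :: "'a calg" and \<pi> :: "(form \<Rightarrow> form) \<Rightarrow> 'a"
    and \<rho>dih :: "(complex \<Rightarrow> complex) \<Rightarrow> 'a mat2"
    and \<psi> :: "'a \<Rightarrow> 'a"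
  assumes "Factorial_Ring.prime p"
    and "field F" and "finite (carrier F)" and "[p] \<cdot>\<^bsub>F\<^esub> \<one>\<^bsub>F\<^esub> = \<zero>\<^bsub>F\<^esub>"
    and "number_field K" and "totally_real K"
    and "quadratic_extension K L"
    and "\<tau> \<in> carrier (Gal K) - carrier (Gal L)"
    and "galois_character L F (residue_calg F) chibar"
    and "\<rho>bar = induced_rep K L \<tau> (residue_calg F) chibar"
    and "absolutely_irreducible_rep (carrier (Gal K)) F \<rho>bar"
    and "totally_odd K F \<rho>bar"
    and "padic_identification p F j"
    and "deformation_property p F K \<rho>bar P"
    and "universal_deformation p F K \<rho>bar P Runiv \<rho>univ"
    and "galois_character L F Runiv chi"
    and "\<forall>g\<in>carrier (Gal L). red Runiv (chi g) = chibar g"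
    and "strictly_equivalent K F Runiv (induced_rep K L \<tau> Runiv chi) \<rho>univ"
    and "unramified_above K p Runiv \<rho>univ"
    and "ideal \<nn> (Int_ring K)"
    and "\<nn> <+>\<^bsub>Int_ring K\<^esub> PIdl\<^bsub>Int_ring K\<^esub> (of_nat p) = carrier (Int_ring K)"
    and "coeff_ring p F Tdih"
    and "hecke_quotient_map p F j K 1 \<nn> Tdih \<pi>"
    and "deformation K F \<rho>bar Tdih \<rho>dih"
    and "\<forall>\<qq>\<in>good_primes K p \<nn>.
           (\<lambda>\<sigma>. tr2 Tdih (\<rho>dih \<sigma>)) ` Frob K \<qq> = {\<pi> (hecke_op K 1 \<nn> \<qq>)}"
    and "\<psi> \<in> ring_hom Tdih Runiv"
    and "strictly_equivalent K F Runiv (\<lambda>g. map_mat2 \<psi> (\<rho>dih g)) \<rho>univ"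
    and "P Tdih \<rho>dih"
  shows "calg_iso p F Runiv Tdih"
proof -
  note F = assms(2,3)
  have univ: "universal_deformation p F K \<rho>bar P Runiv \<rho>univ" by fact
  have R: "coeff_ring p F Runiv" and def: "deformation K F \<rho>bar Runiv \<rho>univ"
    using univ by (auto simp: universal_deformation_def)
  have T: "coeff_ring p F Tdih" by fact
  have defT: "deformation K F \<rho>bar Tdih \<rho>dih" by fact
  have \<psi>: "\<psi> \<in> ring_hom Tdih Runiv" by fact
  note \<rho> = deformation_closed[OF def]
  have cR: "cring Runiv" and strR: "str Runiv \<in> ring_hom (Witt p F) Runiv" and cT: "cring Tdih"
    using R T by (auto simp: coeff_ring_def)
  \<comment> \<open>This is where \<open>P Tdih \<rho>dih\<close> enters: it makes
    \<open>\<rho>dih\<close> a test object for universality.\<close>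
  obtain \<phi> where \<phi>: "\<phi> \<in> calg_hom p F Runiv Tdih"
    and eq: "strictly_equivalent K F Tdih (\<lambda>g. map_mat2 \<phi> (\<rho>univ g)) \<rho>dih"
    using univ T defT \<open>P Tdih \<rho>dih\<close> unfolding universal_deformation_def by blast
  have hom: "\<phi> \<in> ring_hom Runiv Tdih" using \<phi> by (simp add: calg_hom_def)
  have surj: "\<phi> ` carrier Runiv = carrier Tdih"
    by (rule universal_map_surj[OF cT \<phi> cR strR assms(23) assms(25) \<rho> eq])
  have cl: "map_mat2 \<phi> (\<rho>univ g) \<in> carrier (GL2 Tdih)" if "g \<in> carrier (Gal K)" for g
    using map_mat2_GL2_hom[OF cR cT hom] \<rho>[OF that] by (auto simp: hom_def)
  have 1: "strictly_equivalent K F Runiv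
      (\<lambda>g. map_mat2 \<psi> (map_mat2 \<phi> (\<rho>univ g))) (\<lambda>g. map_mat2 \<psi> (\<rho>dih g))"
    by (rule strictly_equivalent_map[OF T R F \<psi> cl eq])
  have "strictly_equivalent K F Runiv (\<lambda>g. map_mat2 \<psi> (map_mat2 \<phi> (\<rho>univ g))) \<rho>univ"
  proof (rule strictly_equivalent_trans[OF R F(1) _ 1 assms(27)])
    fix g assume "g \<in> carrier (Gal K)"
    then show "map_mat2 \<psi> (map_mat2 \<phi> (\<rho>univ g)) \<in> carrier (GL2 Runiv)"
      using map_mat2_GL2_hom[OF cT cR \<psi>] cl by (auto simp: hom_def)
  qed
  then have "strictly_equivalent K F Runiv (\<lambda>g. map_mat2 (\<psi> \<circ> \<phi>) (\<rho>univ g)) \<rho>univ"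
    by (simp add: mat2.map_comp)
  then have "inj_on (\<psi> \<circ> \<phi>) (carrier Runiv)"
    by (rule universal_deformation_endo_inj[OF univ F assms(1,4) ring_hom_trans[OF hom \<psi>]])
  \<comment> \<open>Injectivity of the composite forces that of its inner map, and
    \<open>\<phi>\<close> already is a surjective morphism.\<close>
  then have "inj_on \<phi> (carrier Runiv)" by (rule inj_on_imageI2)
  then show ?thesis using \<phi> surj unfolding calg_iso_def bij_betw_def by blast
qed

end
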